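(* Let $G$ be a finite simple graph with vertex set $V$, let $K$ be a field, let $S=K[V]$, and let $I(G)\subset S$ be the edge ideal of $G$. Let $i,j\ge 0$ be integers. Assume that there exists a subset $W$ of $V$ such that the induced subgraph $G_W$ contains a strongly disjoint set of bouquets of type $(i,j)$. Then $\beta_{i,i+j}(S/I(G))\neq 0$. In particular, $\operatorname{pd} S/I(G)\ge d_G$.
   Context: For a finite simple graph $G$ with vertex set $V=V(G)$ and edge set $E(G)$ and a field $K$, $S=K[V]=K[x:x\in V]$ is the polynomial ring with each variable of degree $1$, and the edge ideal $I(G)\subset S$ is the ideal generated by all products $xy$ with $\{x,y\}\in E(G)$. $\beta_{i,j}(S/I(G))$ denotes the $i$th graded Betti number in degree $j$, i.e. the multiplicity of $S(-j)$ in homological degree $i$ of the minimal graded free resolution of $S/I(G)$ over $S$ (with $S$ in homological degree $0$), and $\operatorname{pd} S/I(G)=\max\{i:\beta_{i,j}(S/I(G))\ne 0\text{ for some }j\}$. For $W\subset V$, $G_W$ is the induced subgraph with vertex set $W$ and edge set $\{e\in E(G): e\subset W\}$. Distance of edges: for distinct edges $e,e'$ of $G$, $\operatorname{dist}_G(e,e')$ is the minimum $\ell$ such that there is a sequence of edges $e_0=e,e_1,\dots,e_\ell=e'$ of $G$ with $e_{k-1}\cap e_k\neq\emptyset$ for all $k$ (and $\infty$ if there is no such sequence). A set of edges is pairwise $3$-disjoint in $G$ if any two distinct edges $e,e'$ of it satisfy $\operatorname{dist}_G(e,e')\ge 3$. Bouquets: a bouquet is a graph $B$ with $V(B)=\{w,z_1,\dots,z_d\}$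 and $E(B)=\{\{w,z_k\}:k=1,\dots,d\}$, $d\ge 1$, with designated root $w$; the $z_k$ are its flowers and the edges $\{w,z_k\}$ its stems. A bouquet of $G$ is a bouquet that is a (not necessarily induced) subgraph of $G$. For a set $\mathcal B$ of bouquets of $G$, $F(\mathcal B)$ and $R(\mathcal B)$ are the sets of vertices that are a flower, respectively a root, of some bouquet in $\mathcal B$. The type of $\mathcal B$ is $(\#F(\mathcal B),\#R(\mathcal B))$. The empty set of bouquets is allowed and has type $(0,0)$. A set $\mathcal B=\{B_1,\dots,B_j\}$ of bouquets of $G$ is strongly disjoint in $G$ if (1) $V(B_k)\cap V(B_\ell)=\emptyset$ for all $k\ne\ell$, and (2) one can choose a stem $s_k$ from each $B_k$ so that $\{s_1,\dots,s_j\}$ is pairwise $3$-disjoint in $G$. A graph $H$ contains a strongly disjoint set of bouquets of type $(i,j)$ if there is a set $\mathcal B$ of bouquets of $H$, strongly disjoint in $H$ and of type $(i,j)$, with $V(H)=F(\mathcal B)\cup R(\mathcal B)$. Finally, $d_G=\max\{\#F(\mathcal B): \mathcal B\text{ is a strongly disjoint set of bouquets of }G\}$. *)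

theory Defs
  imports Complex_Main "HOL-Library.Poly_Mapping" "HOL-Library.Extended_Nat"
begin

section \<open>Polynomial rings $K[V]$ and edge ideals\<close>

text \<open>A monomial is its exponent vector. The type below has all elements of \<^typ>\<open>'v\<close> as variables;
  the ring $K[V]$ is the subset \<open>poly_ring V\<close>.\<close>

type_synonym ('v, 'k) mpoly = "('v \<Rightarrow>\<^sub>0 nat) \<Rightarrow>\<^sub>0 'k"

definition poly_ring :: "'v set \<Rightarrow> ('v, 'k::field) mpoly set" where
  "poly_ring V = {p. \<forall>m\<in>Poly_Mapping.keys p. Poly_Mapping.keys m \<subseteq> V}"

definition var :: "'v \<Rightarrow> ('v, 'k::field) mpoly" where
  "var x = Poly_Mapping.single (Poly_Mapping.single x 1) 1"

definition mon_degree :: "('v \<Rightarrow>\<^sub>0 nat) \<Rightarrow> nat" where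
  "mon_degree m = (\<Sum>x\<in>Poly_Mapping.keys m. Poly_Mapping.lookup m x)"

definition homogeneous :: "nat \<Rightarrow> ('v, 'k::field) mpoly \<Rightarrow> bool" where
  "homogeneous n p \<longleftrightarrow> (\<forall>m\<in>Poly_Mapping.keys p. mon_degree m = n)"

definition is_ideal :: "'v set \<Rightarrow> ('v, 'k::field) mpoly set \<Rightarrow> bool" where
  "is_ideal V I \<longleftrightarrow> I \<subseteq> poly_ring V \<and> 0 \<in> I \<and> (\<forall>p\<in>I. \<forall>q\<in>I. p + q \<in> I)
     \<and> (\<forall>r\<in>poly_ring V. \<forall>p\<in>I. r * p \<in> I)"

definition edge_ideal :: "'v set \<Rightarrow> 'v set set \<Rightarrow> ('v, 'k::field) mpoly set" where
  "edge_ideal V E = is_ideal V hull {var x * var y | x y. {x, y} \<in> E}"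

section \<open>Minimal graded free resolutions and Betti numbers\<close>

text \<open>The free module $\bigoplus_{a} S(-a)^{r(a)}$ over $S = K[V]$, for \<open>r :: nat \<Rightarrow> nat\<close>. Its basis
  elements are the pairs \<open>(a, k)\<close> with \<open>k < r a\<close>, the pair \<open>(a, k)\<close> having degree \<open>a\<close>; a vector is
  the finitely supported family of its coordinates. Only nonnegative degrees \<open>a\<close> are needed: the
  basis elements in a minimal resolution of a cyclic module $S/I$ have degree $\ge 0$.\<close>

type_synonym ('v, 'k) fvec = "(nat \<times> nat) \<Rightarrow>\<^sub>0 ('v, 'k) mpoly"

definition free_module :: "'v set \<Rightarrow> (nat \<Rightarrow> nat) \<Rightarrow> ('v, 'k::field) fvec set" where
  "free_module V r = {f. (\<forall>(a, k)\<in>Poly_Mapping.keys f. k < r a)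
     \<and> (\<forall>c. Poly_Mapping.lookup f c \<in> poly_ring V)}"

definition smul :: "('v, 'k::field) mpoly \<Rightarrow> ('v, 'k) fvec \<Rightarrow> ('v, 'k) fvec" where
  "smul p f = Poly_Mapping.map (\<lambda>q. p * q) f"

definition fvec_homogeneous :: "nat \<Rightarrow> ('v, 'k::field) fvec \<Rightarrow> bool" where
  "fvec_homogeneous n f \<longleftrightarrow>
     (\<forall>(a, k)\<in>Poly_Mapping.keys f. \<forall>m\<in>Poly_Mapping.keys (Poly_Mapping.lookup f (a, k)).
        mon_degree m + a = n)"

text \<open>Degree-preserving $S$-linear maps from a free module to a graded module, which is given by its
  carrier \<open>N\<close>, scalar multiplication \<open>sc\<close> and homogeneity predicate \<open>hom\<close>.\<close>

definition graded_linear ::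
  "'v set \<Rightarrow> (nat \<Rightarrow> nat) \<Rightarrow> (('v, 'k::field) mpoly \<Rightarrow> 'n \<Rightarrow> 'n) \<Rightarrow> (nat \<Rightarrow> 'n \<Rightarrow> bool) \<Rightarrow> 'n::ab_group_add set
     \<Rightarrow> (('v, 'k) fvec \<Rightarrow> 'n) \<Rightarrow> bool" where
  "graded_linear V r sc hom N \<phi> \<longleftrightarrow>
     (\<forall>f\<in>free_module V r. \<phi> f \<in> N)
     \<and> (\<forall>f\<in>free_module V r. \<forall>g\<in>free_module V r. \<phi> (f + g) = \<phi> f + \<phi> g)
     \<and> (\<forall>p\<in>poly_ring V. \<forall>f\<in>free_module V r. \<phi> (smul p f) = sc p (\<phi> f))
     \<and> (\<forall>f\<in>free_module V r. \<forall>n. fvec_homogeneous n f \<longrightarrow> hom n (\<phi> f))"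

text \<open>A complex $\cdots \to F_1 \to F_0 \to S/I \to 0$ with $F_i = \bigoplus_a S(-a)^{b_{i,a}}$ and
  \<open>d i\<close> the differential $F_{i+1} \to F_i$. The augmentation $F_0 \to S/I$ is
  represented by a graded linear lift \<open>\<epsilon>\<close> to $S$, which exists because $F_0$ is free.
  The last condition is minimality: the image of each differential lies in $\mathfrak m F_i$, that is,
  all coordinates have zero constant term.\<close>

definition minimal_graded_free_resolution ::
  "'v set \<Rightarrow> ('v, 'k::field) mpoly set \<Rightarrow> (nat \<Rightarrow> nat \<Rightarrow> nat)
     \<Rightarrow> (nat \<Rightarrow> ('v, 'k) fvec \<Rightarrow> ('v, 'k) fvec) \<Rightarrow> (('v, 'k) fvec \<Rightarrow> ('v, 'k) mpoly) \<Rightarrow> bool" where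
  "minimal_graded_free_resolution V I b d \<epsilon> \<longleftrightarrow>
     graded_linear V (b 0) (*) homogeneous (poly_ring V) \<epsilon>
     \<and> (\<forall>i. graded_linear V (b (Suc i)) smul fvec_homogeneous (free_module V (b i)) (d i))
     \<and> (\<forall>p\<in>poly_ring V. \<exists>f\<in>free_module V (b 0). p - \<epsilon> f \<in> I)
     \<and> d 0 ` free_module V (b 1) = {f\<in>free_module V (b 0). \<epsilon> f \<in> I}
     \<and> (\<forall>i. d (Suc i) ` free_module V (b (Suc (Suc i))) = {f\<in>free_module V (b (Suc i)). d i f = 0})
     \<and> (\<forall>i. \<forall>f\<in>free_module V (b (Suc i)). \<forall>c.
           Poly_Mapping.lookup (Poly_Mapping.lookup (d i f) c) 0 = 0)"

text \<open>\<open>betti V I i j\<close> is $\beta_{i,j}(S/I)$. The minimal graded free resolution is unique up to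
  isomorphism, so the multiplicities do not depend on the choice made here.\<close>

definition betti :: "'v set \<Rightarrow> ('v, 'k::field) mpoly set \<Rightarrow> nat \<Rightarrow> nat \<Rightarrow> nat" where
  "betti V I = (SOME b. \<exists>d \<epsilon>. minimal_graded_free_resolution V I b d \<epsilon>)"

text \<open>The supremum is a maximum, by Hilbert's syzygy theorem.\<close>

definition proj_dim :: "'v set \<Rightarrow> ('v, 'k::field) mpoly set \<Rightarrow> enat" where
  "proj_dim V I = Sup {enat i | i. \<exists>j. betti V I i j \<noteq> 0}"

section \<open>Graphs and bouquets\<close>

definition finite_simple_graph :: "'v set \<Rightarrow> 'v set set \<Rightarrow> bool" where
  "finite_simple_graph V E \<longleftrightarrow> finite V \<and> (\<forall>e\<in>E. e \<subseteq> V \<and> card e = 2)"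

definition induced_edges :: "'v set set \<Rightarrow> 'v set \<Rightarrow> 'v set set" where
  "induced_edges E W = {e\<in>E. e \<subseteq> W}"

text \<open>The infimum in \<^typ>\<open>enat\<close> of the empty set is \<open>\<infinity>\<close>.\<close>

definition edge_dist :: "'v set set \<Rightarrow> 'v set \<Rightarrow> 'v set \<Rightarrow> enat" where
  "edge_dist E e e' = Inf {enat l | l. \<exists>s. s 0 = e \<and> s l = e' \<and> (\<forall>k\<le>l. s k \<in> E)
     \<and> (\<forall>k<l. s k \<inter> s (Suc k) \<noteq> {})}"

definition pairwise_3_disjoint :: "'v set set \<Rightarrow> 'v set set \<Rightarrow> bool" where
  "pairwise_3_disjoint E M \<longleftrightarrow> M \<subseteq> E \<and> pairwise (\<lambda>e e'. edge_dist E e e' \<ge> 3) M"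

text \<open>A bouquet, as a rooted graph, is determined by its root and its set of flowers. The
  conditions that there is a flower and that the root is not one are part of \<open>bouquet_of\<close>.\<close>

datatype 'v bouquet = Bouquet (root: 'v) (flowers: "'v set")

definition bouquet_verts :: "'v bouquet \<Rightarrow> 'v set" where
  "bouquet_verts B = insert (root B) (flowers B)"

definition stems :: "'v bouquet \<Rightarrow> 'v set set" where
  "stems B = {{root B, z} | z. z \<in> flowers B}"

definition bouquet_of :: "'v set \<Rightarrow> 'v set set \<Rightarrow> 'v bouquet \<Rightarrow> bool" where
  "bouquet_of V E B \<longleftrightarrow> finite (flowers B) \<and> flowers B \<noteq> {} \<and> root B \<notin> flowers B
     \<and> bouquet_verts B \<subseteq> V \<and> stems B \<subseteq> E"

definition all_flowers :: "'v bouquet set \<Rightarrow> 'v set" where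
  "all_flowers \<B> = (\<Union>B\<in>\<B>. flowers B)"

definition all_roots :: "'v bouquet set \<Rightarrow> 'v set" where
  "all_roots \<B> = root ` \<B>"

definition strongly_disjoint :: "'v set \<Rightarrow> 'v set set \<Rightarrow> 'v bouquet set \<Rightarrow> bool" where
  "strongly_disjoint V E \<B> \<longleftrightarrow> (\<forall>B\<in>\<B>. bouquet_of V E B)
     \<and> pairwise (\<lambda>B B'. bouquet_verts B \<inter> bouquet_verts B' = {}) \<B>
     \<and> (\<exists>s. (\<forall>B\<in>\<B>. s B \<in> stems B) \<and> pairwise_3_disjoint E (s ` \<B>))"

definition contains_strongly_disjoint :: "'v set \<Rightarrow> 'v set set \<Rightarrow> nat \<Rightarrow> nat \<Rightarrow> bool" where
  "contains_strongly_disjoint V E i j \<longleftrightarrow> (\<exists>\<B>. strongly_disjoint V E \<B>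
     \<and> card (all_flowers \<B>) = i \<and> card (all_roots \<B>) = j
     \<and> V = all_flowers \<B> \<union> all_roots \<B>)"

definition max_flowers :: "'v set \<Rightarrow> 'v set set \<Rightarrow> nat" where
  "max_flowers V E = Max {card (all_flowers \<B>) | \<B>. strongly_disjoint V E \<B>}"

end

theory Submission
  imports Defs
begin

text \<open>Let \<open>R\<close> be the set of the \<open>j\<close> roots and \<open>F\<close> that of the \<open>i\<close> flowers. The Koszul chain
  $(\prod_{w \in R} w)\, e_F$ over $S/I(G)$ is a cycle, because multiplying the product of the roots
  by a flower gives an element of $I(G)$. It is not a boundary: the chosen stems form an induced
  matching, so the sets containing exactly one vertex of each stem are independent, and summing the
  coefficients of a chain at these sets, with suitable signs, annihilates boundaries. Along a minimal
  free resolution the connecting homomorphisms of Koszul homology, injective because free modules have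
  none in positive degree, carry this class of internal degree \<open>i + j\<close> to a nonzero class in degree 0
  of the \<open>i\<close>-th syzygy module, that is, to a minimal generator of degree \<open>i + j\<close>. A minimal resolution
  exists since the graded pieces of a free module over $K[V]$ are finite-dimensional.\<close>

text \<open>The cycle and the functional that detects it come from Hochster's formula. Let W be the
  union of R and F. In multidegree W a Koszul chain over S/I(G) attaches to a set T the squarefree
  monomial on W - T; reading T through X = W - T turns the complex into the cochain complex of the
  independence complex of G_W. The product of the roots is the cochain dual to the face R. It is
  closed because every flower is adjacent to a root, so that R is a facet. The stems at distance at
  least 3 yield a sphere of dimension j - 1, the boundary of a cross-polytope, which has R among its
  facets; evaluating the cochain on this sphere gives 1. This explains the internal degree: i + j is
  the size of W. Since Betti numbers are read from a chosen resolution, the nonvanishing is proved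
  for an arbitrary minimal resolution, and existence then transfers it to the chosen one.\<close>

abbreviation "lookup \<equiv> Poly_Mapping.lookup"
abbreviation "keys \<equiv> Poly_Mapping.keys"
abbreviation "single \<equiv> Poly_Mapping.single"

section \<open>Coordinates of vectors over a polynomial ring\<close>

lemma lookup_smul [simp]: "lookup (smul p f) c = p * lookup f c"
  by (simp add: smul_def map.rep_eq when_def)

interpretation fvec: module "smul :: ('v, 'k::field) mpoly \<Rightarrow> ('v, 'k) fvec \<Rightarrow> ('v, 'k) fvec"
  by unfold_locales (auto intro!: poly_mapping_eqI simp: lookup_add algebra_simps)

text \<open>Restriction of scalars to K, embedded as the constant polynomials. Bases in a fixed
  degree are later chosen by linear algebra over this structure.\<close>

interpretation fvec_space: vector_space
  "\<lambda>(c::'k::field) (f::('v, 'k) fvec). smul (single 0 c) f"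
  by unfold_locales
    (simp_all add: fvec.scale_right_distrib single_add fvec.scale_left_distrib mult_single)

text \<open>The index \<open>c\<close> carries its own degree \<open>fst c\<close>, so the term of
  \<open>f\<close> at \<open>c\<close> and \<open>m\<close> has degree
  \<open>mon_degree m + fst c\<close>.\<close>

definition coef :: "('v, 'k::field) fvec \<Rightarrow> nat \<times> nat \<Rightarrow> ('v \<Rightarrow>\<^sub>0 nat) \<Rightarrow> 'k" where
  "coef f c m = lookup (lookup f c) m"

lemma fvec_eqI: "(\<And>c m. coef f c m = coef g c m) \<Longrightarrow> f = g"
  by (auto intro!: poly_mapping_eqI simp: coef_def)

lemma coef_simps [simp]:
  "coef 0 c m = 0"
  "coef (f + g) c m = coef f c m + coef g c m"
  "coef (f - g) c m = coef f c m - coef g c m"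
  "coef (- f) c m = - coef f c m"
  by (simp_all add: coef_def lookup_add lookup_minus)

lemma coef_sum: "coef (sum F X) c m = (\<Sum>x\<in>X. coef (F x) c m)"
  by (simp add: coef_def lookup_sum)

lemma lookup_single_0_times: "lookup (single 0 k * p) m = (k::'k::field) * lookup p m"
  by (simp add: mult_map_scale_conv_mult [symmetric] map.rep_eq when_def)

lemma coef_scale [simp]: "coef (smul (single 0 k) f) c m = k * coef f c m"
  by (simp add: coef_def lookup_single_0_times)

lemma single_times_eq_sum:
  "single s 1 * p = (\<Sum>m\<in>keys p. single (s + m) (lookup p m))"
  for p :: "('v, 'k::field) mpoly"
proof -
  have "p = (\<Sum>m\<in>keys p. single m (lookup p m))"
    by (rule poly_mapping_eqI) (auto simp: lookup_sum lookup_single when_def in_keys_iff)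
  then have "single s 1 * p = single s 1 * (\<Sum>m\<in>keys p. single m (lookup p m))"
    by simp
  also have "\<dots> = (\<Sum>m\<in>keys p. single (s + m) (lookup p m))"
    by (simp add: sum_distrib_left mult_single)
  finally show ?thesis .
qed

text \<open>Exponents are subtracted with truncation at 0, so the variable has to occur for the
  cancellation.\<close>

lemma minus_single_add_single:
  "lookup m v \<noteq> 0 \<Longrightarrow> single v 1 + (m - single v 1) = (m :: 'v \<Rightarrow>\<^sub>0 nat)"
  by (rule poly_mapping_eqI) (auto simp: lookup_add lookup_minus lookup_single when_def)

lemma lookup_var_times:
  "lookup (var v * p) m = (if lookup m v = 0 then 0 else lookup p (m - single v 1))"
  for p :: "('v, 'k::field) mpoly"
proof -
  have *: "lookup (var v * p) m
      = (\<Sum>s\<in>keys p. if single v 1 + s = m then lookup p s else 0)"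
    by (simp add: var_def single_times_eq_sum lookup_sum lookup_single when_def)
  show ?thesis
  proof (cases "lookup m v = 0")
    case True
    then have "single v 1 + s \<noteq> m" for s
      by (auto simp: lookup_add)
    then show ?thesis using True by (simp add: *)
  next
    case False
    then have "single v 1 + s = m \<longleftrightarrow> s = m - single v 1" for s
      using minus_single_add_single [of m v] by (metis add_diff_cancel_left')
    then show ?thesis using False by (auto simp: * in_keys_iff)
  qed
qed

lemma coef_var:
  "coef (smul (var v) f) c m = (if lookup m v = 0 then 0 else coef f c (m - single v 1))"
  by (simp add: coef_def lookup_var_times)

lemma mon_degree_superset:
  "finite A \<Longrightarrow> keys m \<subseteq> A \<Longrightarrow> mon_degree m = (\<Sum>x\<in>A. lookup m x)"
  unfolding mon_degree_def by (rule sum.mono_neutral_left) (auto simp: in_keys_iff)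

lemma mon_degree_add: "mon_degree (m + n) = mon_degree m + mon_degree n"
proof -
  have "mon_degree (m + n) = (\<Sum>x\<in>keys m \<union> keys n. lookup (m + n) x)"
    by (intro mon_degree_superset) (use keys_add [of m n] in auto)
  then show ?thesis
    by (simp add: lookup_add sum.distrib mon_degree_superset [of "keys m \<union> keys n"])
qed

lemma mon_degree_single [simp]: "mon_degree (single v k) = k"
  by (simp add: mon_degree_def)

lemma mon_degree_eq_0_iff [simp]: "mon_degree m = 0 \<longleftrightarrow> m = 0"
  by (auto simp: mon_degree_def in_keys_iff intro: poly_mapping_eqI)

lemma mon_degree_minus_single:
  "lookup m v \<noteq> 0 \<Longrightarrow> Suc (mon_degree (m - single v 1)) = mon_degree m"
  using mon_degree_add [of "single v 1" "m - single v 1"]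
  using minus_single_add_single [of m v] by simp

lemma fvec_homogeneous_iff:
  "fvec_homogeneous n f \<longleftrightarrow> (\<forall>c m. coef f c m \<noteq> 0 \<longrightarrow> mon_degree m + fst c = n)"
proof -
  have "coef f (a, b) m \<noteq> 0 \<longleftrightarrow> (a, b) \<in> keys f \<and> m \<in> keys (lookup f (a, b))" for a b m
    by (auto simp: in_keys_iff coef_def)
  then show ?thesis
    by (fastforce simp: fvec_homogeneous_def)
qed

lemma free_module_iff:
  "f \<in> free_module V r \<longleftrightarrow> (\<forall>c m. coef f c m \<noteq> 0 \<longrightarrow> snd c < r (fst c) \<and> keys m \<subseteq> V)"
proof -
  have "(\<exists>m. coef f (a, b) m \<noteq> 0) \<longleftrightarrow> (a, b) \<in> keys f" for a b
    by (auto simp: in_keys_iff coef_def intro!: poly_mapping_eqI)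
  moreover have "coef f c m \<noteq> 0 \<longleftrightarrow> m \<in> keys (lookup f c)" for c m
    by (auto simp: in_keys_iff coef_def)
  ultimately show ?thesis
    unfolding free_module_def poly_ring_def by auto blast+
qed

lemma free_moduleD:
  "f \<in> free_module V r \<Longrightarrow> coef f c m \<noteq> 0 \<Longrightarrow> snd c < r (fst c) \<and> keys m \<subseteq> V"
  by (auto simp only: free_module_iff)

lemma homogeneousD: "fvec_homogeneous n f \<Longrightarrow> coef f c m \<noteq> 0 \<Longrightarrow> mon_degree m + fst c = n"
  by (auto simp only: fvec_homogeneous_iff)

lemma homogeneous_0 [simp]: "fvec_homogeneous n 0"
  by (simp add: fvec_homogeneous_iff)

lemma homogeneous_add:
  "fvec_homogeneous n f \<Longrightarrow> fvec_homogeneous n g \<Longrightarrow> fvec_homogeneous n (f + g)"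
  unfolding fvec_homogeneous_iff coef_simps by (metis add_0)

lemma homogeneous_sum:
  "(\<And>x. x \<in> X \<Longrightarrow> fvec_homogeneous n (F x)) \<Longrightarrow> fvec_homogeneous n (sum F X)"
  by (induction X rule: infinite_finite_induct) (auto intro: homogeneous_add)

lemma homogeneous_scale:
  "fvec_homogeneous n f \<Longrightarrow> fvec_homogeneous n (smul (single 0 k) f)"
  unfolding fvec_homogeneous_iff by (metis coef_scale mult_zero_right)

lemma homogeneous_var: "fvec_homogeneous n f \<Longrightarrow> fvec_homogeneous (Suc n) (smul (var v) f)"
  unfolding fvec_homogeneous_iff coef_var
  by (metis add_Suc mon_degree_minus_single)

lemma poly_ring_closed:
  "(0::('v, 'k::field) mpoly) \<in> poly_ring V" "(1::('v, 'k::field) mpoly) \<in> poly_ring V"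
  "single 0 (k::'k::field) \<in> poly_ring V"
  "v \<in> V \<Longrightarrow> (var v::('v, 'k::field) mpoly) \<in> poly_ring V"
  by (auto simp: poly_ring_def var_def)

lemma poly_ring_add: "p \<in> poly_ring V \<Longrightarrow> q \<in> poly_ring V \<Longrightarrow> p + q \<in> poly_ring V"
  using keys_add [of p q] by (auto simp: poly_ring_def)

lemma poly_ring_mult: "p \<in> poly_ring V \<Longrightarrow> q \<in> poly_ring V \<Longrightarrow> p * q \<in> poly_ring V"
proof -
  assume pq: "p \<in> poly_ring V" "q \<in> poly_ring V"
  show ?thesis unfolding poly_ring_def
  proof safe
    fix m x assume "m \<in> keys (p * q)" "x \<in> keys m"
    then obtain a b where "a \<in> keys p" "b \<in> keys q" "x \<in> keys (a + b)"
      using keys_mult [of p q] by blast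
    then show "x \<in> V" using pq keys_add [of a b] unfolding poly_ring_def by blast
  qed
qed

lemma free_module_lookup: "f \<in> free_module V r \<Longrightarrow> lookup f c \<in> poly_ring V"
  by (cases c) (simp add: free_module_def)

section \<open>Submodules of free modules\<close>

definition submodule_over :: "'v set \<Rightarrow> ('v, 'k::field) fvec set \<Rightarrow> bool" where
  "submodule_over V N \<longleftrightarrow> 0 \<in> N \<and> (\<forall>f\<in>N. \<forall>g\<in>N. f + g \<in> N) \<and> (\<forall>p\<in>poly_ring V. \<forall>f\<in>N. smul p f \<in> N)"

lemma submodule_overD:
  assumes "submodule_over V N"
  shows "0 \<in> N" "f \<in> N \<Longrightarrow> g \<in> N \<Longrightarrow> f + g \<in> N" "p \<in> poly_ring V \<Longrightarrow> f \<in> N \<Longrightarrow> smul p f \<in> N"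
  using assms by (auto simp: submodule_over_def)

lemma submodule_over_uminus: "submodule_over V N \<Longrightarrow> f \<in> N \<Longrightarrow> - f \<in> N"
proof -
  assume N: "submodule_over V N" "f \<in> N"
  have "smul (single 0 (-1)) f = - f"
    by (rule fvec_eqI) simp
  then show ?thesis
    using N by (metis submodule_overD(3) poly_ring_closed(3))
qed

lemma submodule_over_minus: "submodule_over V N \<Longrightarrow> f \<in> N \<Longrightarrow> g \<in> N \<Longrightarrow> f - g \<in> N"
  using submodule_overD(2) [of V N f "- g"] submodule_over_uminus [of V N g] by simp

lemma submodule_over_sum:
  "submodule_over V N \<Longrightarrow> (\<And>x. x \<in> X \<Longrightarrow> F x \<in> N) \<Longrightarrow> sum F X \<in> N"
  by (induction X rule: infinite_finite_induct) (auto dest: submodule_overD)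

lemma submodule_over_0 [simp]: "submodule_over V {0}"
  by (simp add: submodule_over_def)

lemma submodule_free_module [simp]: "submodule_over V (free_module V r :: ('v, 'k::field) fvec set)"
  unfolding submodule_over_def
proof (intro conjI ballI)
  fix p :: "('v, 'k) mpoly" and f :: "('v, 'k) fvec"
  assume p: "p \<in> poly_ring V" and f: "f \<in> free_module V r"
  have "keys (smul p f) \<subseteq> keys f"
    by (auto simp: in_keys_iff)
  then show "smul p f \<in> free_module V r"
    using p f by (auto simp: free_module_def intro: poly_ring_mult)
next
  fix f g :: "('v, 'k) fvec"
  assume "f \<in> free_module V r" "g \<in> free_module V r"
  then show "f + g \<in> free_module V r"
    unfolding free_module_iff coef_simps by (metis add_0)
qed (simp add: free_module_iff)

section \<open>Homogeneous components and graded submodules\<close>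

definition component :: "nat \<Rightarrow> ('v, 'k::field) fvec \<Rightarrow> ('v, 'k) fvec" where
  "component n f = Poly_Mapping.mapp (\<lambda>c. Poly_Mapping.mapp (\<lambda>m k. if mon_degree m + fst c = n then k else 0)) f"

lemma coef_component: "coef (component n f) c m = (if mon_degree m + fst c = n then coef f c m else 0)"
  by (auto simp: component_def coef_def lookup_mapp in_keys_iff when_def)

lemma component_add: "component n (f + g) = component n f + component n g"
  by (rule fvec_eqI) (simp add: coef_component)

lemma component_0 [simp]: "component n 0 = 0"
  by (rule fvec_eqI) (simp add: coef_component)

lemma component_minus: "component n (f - g) = component n f - component n g"
  by (rule fvec_eqI) (simp add: coef_component)

lemma component_sum: "component n (sum F X) = (\<Sum>x\<in>X. component n (F x))"
  by (induction X rule: infinite_finite_induct) (auto simp: component_add)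

lemma homogeneous_component: "fvec_homogeneous n (component n f)"
  by (auto simp: fvec_homogeneous_iff coef_component)

lemma component_homogeneous: "fvec_homogeneous n f \<Longrightarrow> component m f = (if m = n then f else 0)"
proof (rule fvec_eqI)
  fix c k assume "fvec_homogeneous n f"
  then have "coef f c k = 0 \<or> mon_degree k + fst c = n"
    unfolding fvec_homogeneous_iff by blast
  then show "coef (component m f) c k = coef (if m = n then f else 0) c k"
    by (auto simp: coef_component)
qed

lemma component_free_module: "f \<in> free_module V r \<Longrightarrow> component n f \<in> free_module V r"
  by (simp add: free_module_iff coef_component)

lemma sum_component: "\<exists>D. finite D \<and> f = (\<Sum>n\<in>D. component n f)"
proof (intro exI conjI)
  let ?D = "\<Union>c\<in>keys f. (\<lambda>m. mon_degree m + fst c) ` keys (lookup f c)"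
  show D: "finite ?D" by simp
  show "f = (\<Sum>n\<in>?D. component n f)"
  proof (rule fvec_eqI)
    fix c m
    have "mon_degree m + fst c \<in> ?D" if "coef f c m \<noteq> 0"
      using that by (auto simp: coef_def in_keys_iff intro!: bexI [of _ c] imageI)
    then show "coef f c m = coef (\<Sum>n\<in>?D. component n f) c m"
      using D by (auto simp: coef_sum coef_component sum.delta)
  qed
qed

text \<open>Closure under components is the form of gradedness that turns arbitrary lifts into
  homogeneous ones.\<close>

definition graded_submodule :: "'v set \<Rightarrow> ('v, 'k::field) fvec set \<Rightarrow> bool" where
  "graded_submodule V N \<longleftrightarrow> submodule_over V N \<and> (\<forall>n. \<forall>f\<in>N. component n f \<in> N)"

lemma graded_submodule_0 [simp]: "graded_submodule V {0}"
  by (simp add: graded_submodule_def)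

section \<open>Graded maps between free modules\<close>

abbreviation "graded_map V r r' \<equiv> graded_linear V r smul fvec_homogeneous (free_module V r')"

lemma graded_mapD:
  assumes "graded_map V r r' \<phi>"
  shows "f \<in> free_module V r \<Longrightarrow> \<phi> f \<in> free_module V r'"
    "f \<in> free_module V r \<Longrightarrow> g \<in> free_module V r \<Longrightarrow> \<phi> (f + g) = \<phi> f + \<phi> g"
    "p \<in> poly_ring V \<Longrightarrow> f \<in> free_module V r \<Longrightarrow> \<phi> (smul p f) = smul p (\<phi> f)"
    "f \<in> free_module V r \<Longrightarrow> fvec_homogeneous n f \<Longrightarrow> fvec_homogeneous n (\<phi> f)"
  using assms by (auto simp: graded_linear_def)

lemma graded_map_0: "graded_map V r r' \<phi> \<Longrightarrow> \<phi> 0 = 0"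
  using graded_mapD(3) [of V r r' \<phi> 0 0] by (simp add: poly_ring_closed submodule_overD [OF submodule_free_module])

lemma graded_map_minus:
  assumes "graded_map V r r' \<phi>" "f \<in> free_module V r" "g \<in> free_module V r"
  shows "\<phi> (f - g) = \<phi> f - \<phi> g"
  using graded_mapD(2) [OF assms(1), of "f - g" g] assms
  by (simp add: submodule_over_minus [OF submodule_free_module] algebra_simps)

lemma graded_map_sum:
  assumes "graded_map V r r' \<phi>" "\<And>x. x \<in> X \<Longrightarrow> F x \<in> free_module V r"
  shows "\<phi> (sum F X) = (\<Sum>x\<in>X. \<phi> (F x))"
  using assms(2)
proof (induction X rule: infinite_finite_induct)
  case (insert x X)
  then have "sum F X \<in> free_module V r"
    by (intro submodule_over_sum [OF submodule_free_module]) auto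
  then show ?case using insert by (simp add: graded_mapD(2) [OF assms(1)])
qed (simp_all add: graded_map_0 [OF assms(1)])

text \<open>Additivity applied to the decomposition of \<open>f\<close> leaves one image in each
  degree, and taking the component of degree \<open>n\<close> discards all but one of them.\<close>

lemma graded_map_component:
  assumes \<phi>: "graded_map V r r' \<phi>" and f: "f \<in> free_module V r"
  shows "\<phi> (component n f) = component n (\<phi> f)"
proof -
  obtain D where D: "finite D" "f = (\<Sum>k\<in>D. component k f)"
    using sum_component by blast
  have "\<phi> f = (\<Sum>k\<in>D. \<phi> (component k f))"
    using D f graded_map_sum [OF \<phi>, of D "\<lambda>k. component k f"] by (metis component_free_module)
  then have "component n (\<phi> f) = (\<Sum>k\<in>D. component n (\<phi> (component k f)))"
    by (simp add: component_sum)
  also have "\<dots> = (\<Sum>k\<in>D. if n = k then \<phi> (component n f) else 0)"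
    by (intro sum.cong) (auto simp: component_homogeneous
        [OF graded_mapD(4) [OF \<phi> component_free_module [OF f] homogeneous_component]])
  also have "\<dots> = (\<Sum>k\<in>D. \<phi> (component n (component k f)))"
    using graded_map_0 [OF \<phi>]
    by (intro sum.cong) (auto simp: component_homogeneous [OF homogeneous_component])
  also have "\<dots> = \<phi> (component n (\<Sum>k\<in>D. component k f))"
    by (simp only: component_sum)
      (rule graded_map_sum [OF \<phi>, symmetric], auto intro!: component_free_module f)
  finally show ?thesis using D by simp
qed

text \<open>Needed for \<open>J = {0}\<close>: a syzygy module is again graded, so a resolution can
  be continued.\<close>

lemma graded_preimage:
  assumes \<phi>: "graded_map V r r' \<phi>" and J: "graded_submodule V J"
  shows "graded_submodule V {f \<in> free_module V r. \<phi> f \<in> J}"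
  using J unfolding graded_submodule_def submodule_over_def
  by (auto simp: graded_map_0 [OF \<phi>] graded_mapD [OF \<phi>] graded_map_component [OF \<phi>]
      component_free_module submodule_overD [OF submodule_free_module])

section \<open>The Koszul complex\<close>

text \<open>The order is left arbitrary: the general theory works for any, and the application to
  bouquets picks one adapted to the stems.\<close>

locale ordered_variables =
  fixes V :: "'v set" and num :: "'v \<Rightarrow> nat"
  assumes finite_V: "finite V" and inj_num: "inj_on num V"
begin

text \<open>\<open>div_least v\<close> divides by \<open>v\<close> the monomials whose least variable is \<open>v\<close> and drops all others;
  \<open>tail_part v\<close> drops the monomials containing a variable less than \<open>v\<close>.\<close>

definition div_least :: "'v \<Rightarrow> ('v, 'k::field) fvec \<Rightarrow> ('v, 'k) fvec" where
  "div_least v f = Poly_Mapping.map (\<lambda>p. Poly_Mapping.map_key (\<lambda>m. m + single v 1)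
     (Poly_Mapping.mapp (\<lambda>m k. if \<forall>u\<in>keys (m - single v 1). num v \<le> num u then k else 0) p)) f"

definition tail_part :: "'v \<Rightarrow> ('v, 'k::field) fvec \<Rightarrow> ('v, 'k) fvec" where
  "tail_part v f = Poly_Mapping.map
     (Poly_Mapping.mapp (\<lambda>m k. if \<forall>u\<in>keys m. num v \<le> num u then k else 0)) f"

lemma coef_div_least: "coef (div_least v f) c m = (if \<forall>u\<in>keys m. num v \<le> num u then coef f c (m + single v 1) else 0)"
proof -
  have "inj (\<lambda>m. m + single v (1::nat))"
    by (rule injI) simp
  then show ?thesis
    by (auto simp: div_least_def coef_def map.rep_eq when_def map_key.rep_eq lookup_mapp in_keys_iff)
qed

lemma coef_tail_part: "coef (tail_part v f) c m = (if \<forall>u\<in>keys m. num v \<le> num u then coef f c m else 0)"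
  by (auto simp: tail_part_def coef_def map.rep_eq when_def lookup_mapp in_keys_iff)

lemma div_least_0 [simp]: "div_least v 0 = 0"
  by (rule fvec_eqI) (simp add: coef_div_least)

lemma div_least_add: "div_least v (f + g) = div_least v f + div_least v g"
  by (rule fvec_eqI) (simp add: coef_div_least)

lemma div_least_sum: "div_least v (sum F X) = (\<Sum>x\<in>X. div_least v (F x))"
  by (induction X rule: infinite_finite_induct) (auto simp: div_least_add)

lemma keys_add_single: "keys (m + single v (1::nat)) = insert v (keys m)"
  by (auto simp: in_keys_iff lookup_add lookup_single when_def split: if_splits)

lemma div_least_free_module: "f \<in> free_module V r \<Longrightarrow> div_least v f \<in> free_module V r"
  using free_moduleD [of f V r _ "_ + single v 1"]
  unfolding free_module_iff [of "div_least v f"] coef_div_least keys_add_single by auto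

lemma coef_var_div_least:
  "coef (smul (var u) (div_least u f)) c m
     = (if u \<in> keys m \<and> (\<forall>w\<in>keys m. num u \<le> num w) then coef f c m else 0)"
proof (cases "lookup m u = 0")
  case False
  have "keys m = insert u (keys (m - single u 1))"
    using minus_single_add_single [OF False] keys_add_single [of "m - single u 1" u]
    by (simp add: add.commute)
  then have "(\<forall>w\<in>keys (m - single u 1). num u \<le> num w) \<longleftrightarrow> (\<forall>w\<in>keys m. num u \<le> num w)"
    by auto
  then show ?thesis using False minus_single_add_single [OF False]
    by (simp add: coef_var coef_div_least add.commute in_keys_iff)
qed (simp add: coef_var in_keys_iff)

text \<open>Each monomial is counted once: either none of its variables precedes \<open>v\<close>,
  or its least variable \<open>u\<close> does, and then only the summand of \<open>u\<close> keeps
  it.\<close>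

lemma sum_var_div_least:
  assumes f: "f \<in> free_module V r" and v: "v \<in> V"
  shows "(\<Sum>u | u \<in> V \<and> num u < num v. smul (var u) (div_least u f)) + tail_part v f = f"
proof (rule fvec_eqI)
  fix c m
  show "coef ((\<Sum>u | u \<in> V \<and> num u < num v. smul (var u) (div_least u f)) + tail_part v f) c m = coef f c m"
  proof (cases "keys m \<subseteq> V")
    case False
    then have "coef f c m = 0" using free_moduleD [OF f] by blast
    then show ?thesis by (simp add: coef_sum coef_var_div_least coef_tail_part cong: if_cong)
  next
    case m: True
    show ?thesis
    proof (cases "\<forall>u\<in>keys m. num v \<le> num u")
      case True
      then have "(\<Sum>u | u \<in> V \<and> num u < num v. coef (smul (var u) (div_least u f)) c m) = 0"
        by (intro sum.neutral) (auto simp: coef_var_div_least)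
      then show ?thesis using True by (simp add: coef_sum coef_tail_part)
    next
      case False
      define w where "w = arg_min_on num (keys m)"
      have "keys m \<noteq> {}" using False by auto
      then have w: "w \<in> keys m" "\<forall>u\<in>keys m. num w \<le> num u"
        unfolding w_def by (auto intro: arg_min_if_finite arg_min_least)
      have wv: "num w < num v" using False w(2) by force
      have eq: "u = w" if "u \<in> keys m" "\<forall>x\<in>keys m. num u \<le> num x" for u
        using that w m inj_num by (meson inj_onD order_antisym subset_iff)
      have "(\<Sum>u | u \<in> V \<and> num u < num v. coef (smul (var u) (div_least u f)) c m)
          = (\<Sum>u | u \<in> V \<and> num u < num v. if u = w then coef f c m else 0)"
        using w by (intro sum.cong) (auto simp: coef_var_div_least dest: eq)
      also have "\<dots> = coef f c m" using wv w(1) m finite_V by (auto simp: sum.delta)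
      finally show ?thesis using False by (auto simp: coef_sum coef_tail_part)
    qed
  qed
qed

text \<open>The commutation rules behind the contracting homotopy. If \<open>u\<close> precedes
  \<open>v\<close>, no multiple of \<open>u\<close> has \<open>v\<close> as its least variable; if
  \<open>u = v\<close>, division undoes multiplication on the monomials that it retains; if
  \<open>u\<close> comes later, multiplying by it does not affect whether a variable below
  \<open>v\<close> occurs. The assumption excludes ties, as \<open>num\<close> is injective only on
  \<open>V\<close>.\<close>

lemma div_least_var:
  assumes uv: "u = v \<or> num u \<noteq> num v"
  shows "div_least v (smul (var u) f) = (if num u < num v then 0 else if u = v then tail_part v f else smul (var u) (div_least v f))"
proof (rule fvec_eqI)
  fix c m
  consider "num u < num v" | "u = v" | "num v < num u" "u \<noteq> v"
    using uv by (cases "num u" "num v" rule: linorder_cases) auto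
  then show "coef (div_least v (smul (var u) f)) c m
    = coef (if num u < num v then 0 else if u = v then tail_part v f else smul (var u) (div_least v f)) c m"
  proof cases
    case 1
    have "lookup m u = 0" if "\<forall>w\<in>keys m. num v \<le> num w"
      using 1 that by (force simp: in_keys_iff)
    then show ?thesis using 1
      by (auto simp: coef_div_least coef_var lookup_add lookup_single when_def)
  next
    case 2
    then show ?thesis by (simp add: coef_div_least coef_tail_part coef_var lookup_add)
  next
    case 3
    show ?thesis
    proof (cases "lookup m u = 0")
      case True
      then show ?thesis using 3 by (simp add: coef_div_least coef_var lookup_add lookup_single when_def)
    next
      case False
      have "keys m = insert u (keys (m - single u 1))"
        using minus_single_add_single [OF False] keys_add_single [of "m - single u 1" u]
        by (simp add: add.commute)
      then have iff: "(\<forall>w\<in>keys (m - single u 1). num v \<le> num w) \<longleftrightarrow> (\<forall>w\<in>keys m. num v \<le> num w)"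
        using 3 by auto
      have "m + single v 1 - single u 1 = m - single u 1 + single v 1"
        using 3 by (intro poly_mapping_eqI) (auto simp: lookup_add lookup_minus lookup_single when_def)
      then show ?thesis using 3 False iff by (simp add: coef_div_least coef_var lookup_add)
    qed
  qed
qed

text \<open>Without constant terms every monomial has a least variable. This exhibits
  \<open>f\<close> as an element of m F, m being the ideal of the variables, with explicit
  quotients.\<close>

lemma sum_var_div_least_all:
  assumes f: "f \<in> free_module V r" and const: "\<And>c. coef f c 0 = 0"
  shows "(\<Sum>u\<in>V. smul (var u) (div_least u f)) = f"
proof (rule fvec_eqI)
  fix c m
  show "coef (\<Sum>u\<in>V. smul (var u) (div_least u f)) c m = coef f c m"
  proof (cases "coef f c m = 0")
    case True
    then show ?thesis by (simp add: coef_sum coef_var_div_least cong: if_cong)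
  next
    case False
    then have m: "keys m \<subseteq> V" "keys m \<noteq> {}"
      using free_moduleD [OF f False] const [of c] by (blast, auto)
    define w where "w = arg_min_on num (keys m)"
    have w: "w \<in> keys m" "\<forall>u\<in>keys m. num w \<le> num u"
      unfolding w_def using m by (auto intro: arg_min_if_finite arg_min_least)
    have eq: "u = w" if "u \<in> keys m" "\<forall>x\<in>keys m. num u \<le> num x" for u
      using that w m inj_num by (meson inj_onD order_antisym subset_iff)
    have "(\<Sum>u\<in>V. coef (smul (var u) (div_least u f)) c m) = (\<Sum>u\<in>V. if u = w then coef f c m else 0)"
      using w by (intro sum.cong) (auto simp: coef_var_div_least dest: eq)
    also have "\<dots> = coef f c m" using w(1) m finite_V by (auto simp: sum.delta)
    finally show ?thesis by (simp add: coef_sum)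
  qed
qed

text \<open>A Koszul chain of degree \<open>p\<close> is a family of vectors, the coefficients of the exterior
  basis elements, indexed by the subsets \<open>T\<close> of \<open>V\<close> of cardinality \<open>p\<close>.\<close>

definition sg :: "'v \<Rightarrow> 'v set \<Rightarrow> 'k::field" where
  "sg v T = (-1) ^ card {t \<in> T. num t < num v}"

text \<open>The Koszul differential read coefficientwise: the value at \<open>T\<close> collects
  what arises by removing some \<open>v\<close> from \<open>insert v T\<close>, with the sign of the
  position of \<open>v\<close>.\<close>

definition boundary :: "('v set \<Rightarrow> ('v, 'k::field) fvec) \<Rightarrow> 'v set \<Rightarrow> ('v, 'k) fvec" where
  "boundary c T = (\<Sum>v\<in>V - T. smul (single 0 (sg v T)) (smul (var v) (c (insert v T))))"

lemma sg_insert: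
  assumes "finite T" "u \<notin> T"
  shows "sg v (insert u T) = (if num u < num v then - sg v T else sg v T)"
proof -
  have "{t \<in> insert u T. num t < num v}
      = (if num u < num v then insert u {t \<in> T. num t < num v} else {t \<in> T. num t < num v})"
    by auto
  then show ?thesis using assms by (simp add: sg_def)
qed

text \<open>Removing \<open>u\<close> and \<open>v\<close> in the two orders gives opposite signs,
  since exactly one of the two insertions flips a sign. The pairs are split by their order and
  matched by swapping, because antisymmetry alone only shows that twice the sum vanishes.\<close>

lemma boundary_boundary:
  fixes c :: "'v set \<Rightarrow> ('v, 'k::field) fvec"
  assumes T: "T \<subseteq> V"
  shows "boundary (boundary c) T = 0"
proof -
  have finT: "finite T" using T finite_V finite_subset by blast
  define F where "F v u = smul (single 0 (sg v T * sg u (insert v T))) (smul (var v * var u) (c (insert u (insert v T))))"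
    for u v
  have F: "F v u = - F u v" if "v \<in> V - T" "u \<in> V - T" "v \<noteq> u" for u v
  proof -
    have "num u \<noteq> num v" using that inj_num by (auto dest: inj_onD)
    then have "(sg v T * sg u (insert v T) :: 'k) = - (sg u T * sg v (insert u T))"
      using that by (auto simp: sg_insert [OF finT])
    moreover have "insert u (insert v T) = insert v (insert u T)" by auto
    ultimately show ?thesis by (simp add: F_def mult.commute [of "var v"] single_uminus)
  qed
  have neq: "\<forall>a\<in>V. \<forall>b\<in>V. a \<noteq> b \<longrightarrow> num a < num b \<or> num b < num a"
    using inj_onD [OF inj_num] nat_neq_iff by blast
  have "boundary (boundary c) T = (\<Sum>v\<in>V - T. \<Sum>u\<in>V - insert v T. F v u)"
    by (simp add: boundary_def F_def fvec.scale_sum_right mult_single ac_simps)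
  also have "\<dots> = (\<Sum>(v, u)\<in>Sigma (V - T) (\<lambda>v. V - insert v T). F v u)"
    using finite_V by (simp add: sum.Sigma)
  also have "Sigma (V - T) (\<lambda>v. V - insert v T)
    = {(v, u) \<in> (V - T) \<times> (V - T). num v < num u} \<union> {(v, u) \<in> (V - T) \<times> (V - T). num u < num v}"
    using neq by blast
  also have "(\<Sum>(v, u)\<in>\<dots>. F v u) = (\<Sum>(v, u)\<in>{(v, u) \<in> (V - T) \<times> (V - T). num v < num u}. F v u)
     + (\<Sum>(v, u)\<in>{(v, u) \<in> (V - T) \<times> (V - T). num u < num v}. F v u)"
    using finite_V by (intro sum.union_disjoint)
       (auto intro!: finite_subset [OF _ finite_cartesian_product [of V V]])
  also have "(\<Sum>(v, u)\<in>{(v, u) \<in> (V - T) \<times> (V - T). num u < num v}. F v u)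
      = (\<Sum>(v, u)\<in>{(v, u) \<in> (V - T) \<times> (V - T). num v < num u}. - F v u)"
    by (rule sum.reindex_bij_witness [of _ prod.swap prod.swap]) (auto intro!: F [symmetric])
  finally show ?thesis by (simp add: case_prod_unfold sum_negf)
qed

section \<open>Exactness of the Koszul complex of a free module\<close>

definition first :: "'v set \<Rightarrow> 'v" where
  "first T = arg_min_on num T"

text \<open>Unlike the homotopy given by the Euler formula, this one needs no division by the degree, so
  it works in every characteristic.\<close>

definition homotopy :: "('v set \<Rightarrow> ('v, 'k::field) fvec) \<Rightarrow> 'v set \<Rightarrow> ('v, 'k) fvec" where
  "homotopy c T = div_least (first T) (c (T - {first T}))"

lemma first:
  assumes "T \<subseteq> V" "T \<noteq> {}"
  shows "first T \<in> T" "u \<in> T \<Longrightarrow> u \<noteq> first T \<Longrightarrow> num (first T) < num u"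
proof -
  have T: "finite T" using assms finite_V finite_subset by blast
  show *: "first T \<in> T" unfolding first_def using T assms by (simp add: arg_min_if_finite)
  assume u: "u \<in> T" "u \<noteq> first T"
  then have "num (first T) \<le> num u" unfolding first_def using T assms by (intro arg_min_least)
  moreover have "num (first T) \<noteq> num u" using u * assms inj_num by (auto dest: inj_onD)
  ultimately show "num (first T) < num u" by simp
qed

lemma first_eqI:
  assumes "T \<subseteq> V" "v \<in> T" "\<And>u. u \<in> T \<Longrightarrow> num v \<le> num u"
  shows "first T = v"
  using first [of T] assms by (metis empty_iff leD)

lemma div_least_scale: "div_least v (smul (single 0 k) f) = smul (single 0 k) (div_least v f)"
  by (rule fvec_eqI) (simp add: coef_div_least)

text \<open>Split the variables outside \<open>T\<close> at its least element \<open>v\<close>.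
  Those below \<open>v\<close> become the new first element and rebuild the part of
  \<open>c T\<close> whose least variable precedes \<open>v\<close>. Those above leave
  \<open>v\<close> first and contribute \<open>- S\<close>; the cycle equation at
  \<open>T - {v}\<close>, divided by \<open>v\<close>, identifies this with the remaining part of
  \<open>c T\<close>.\<close>

lemma boundary_homotopy:
  assumes T: "T \<subseteq> V" "T \<noteq> {}" and c: "c T \<in> free_module V r"
    and cycle: "boundary c (T - {first T}) = 0"
  shows "boundary (homotopy c) T = c T"
proof -
  define v where "v = first T"
  define T' where "T' = T - {v}"
  have v: "v \<in> T" "v \<in> V" and min: "u \<in> T \<Longrightarrow> u \<noteq> v \<Longrightarrow> num v < num u" for u
    using first [OF T] T by (auto simp: v_def)
  have finT: "finite T" "finite T'" using T finite_V finite_subset by (auto simp: T'_def)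
  have T': "insert v T' = T" "v \<notin> T'" using v by (auto simp: T'_def)
  have ne: "num u \<noteq> num v" if "u \<in> V - T" for u using that v inj_num by (auto dest: inj_onD)
  let ?L = "{u \<in> V. num u < num v}" and ?G = "{u \<in> V. u \<notin> T \<and> num v < num u}"
  have split: "V - T = ?L \<union> ?G" "?L \<inter> ?G = {}"
  proof -
    have "\<forall>u\<in>T. \<not> num u < num v" using min by (metis less_asym less_irrefl)
    moreover have "\<forall>u\<in>V - T. num u < num v \<or> num v < num u" using ne nat_neq_iff by blast
    ultimately show "V - T = ?L \<union> ?G" "?L \<inter> ?G = {}" by auto
  qed
  define S where "S = (\<Sum>u\<in>?G. smul (single 0 (sg u T')) (smul (var u) (div_least v (c (insert u T')))))"
  have sg1: "sg u A = 1" if "\<And>t. t \<in> A \<Longrightarrow> num u \<le> num t" for u A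
  proof -
    have "{t \<in> A. num t < num u} = {}" using that by force
    then show ?thesis unfolding sg_def by (simp only: card.empty power_0)
  qed
  \<comment> \<open>Under the division, variables below \<open>v\<close> drop out, \<open>v\<close>
    itself leaves the tail part, and the rest form \<open>S\<close>.\<close>
  have "0 = div_least v (boundary c T')"
    using cycle by (simp add: T'_def v_def)
  also have "\<dots> = (\<Sum>u\<in>V - T'. smul (single 0 (sg u T')) (div_least v (smul (var u) (c (insert u T')))))"
    unfolding boundary_def div_least_sum div_least_scale ..
  also have "V - T' = insert v (V - T)" using v by (auto simp: T'_def)
  also have "(\<Sum>u\<in>insert v (V - T). smul (single 0 (sg u T')) (div_least v (smul (var u) (c (insert u T')))))
    = smul (single 0 (sg v T')) (tail_part v (c T))
      + (\<Sum>u\<in>V - T. smul (single 0 (sg u T')) (div_least v (smul (var u) (c (insert u T')))))"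
    using finite_V v by (simp add: div_least_var T')
  also have "sg v T' = 1" using min by (intro sg1) (auto simp: T'_def less_imp_le)
  also have "(\<Sum>u\<in>V - T. smul (single 0 (sg u T')) (div_least v (smul (var u) (c (insert u T'))))) = S"
    unfolding split(1) S_def using finite_V split(2)
    by (subst sum.union_disjoint) (auto simp: div_least_var intro!: sum.cong)
  finally have S: "S = - tail_part v (c T)" by (simp add: eq_neg_iff_add_eq_0 add.commute)
  have low: "homotopy c (insert u T) = div_least u (c T)" "sg u T = 1" if u: "u \<in> ?L" for u
  proof -
    have lt: "num u \<le> num t" if "t \<in> T" for t using that u min [of t] by (cases "t = v") auto
    then have "first (insert u T) = u" using u T by (intro first_eqI) auto
    moreover have "u \<notin> T" using u split by auto
    ultimately show "homotopy c (insert u T) = div_least u (c T)" by (simp add: homotopy_def)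
    show "sg u T = 1" using lt by (rule sg1)
  qed
  have high: "homotopy c (insert u T) = div_least v (c (insert u T'))" "sg u T = - sg u T'" if u: "u \<in> ?G" for u
  proof -
    have "num v \<le> num t" if "t \<in> insert u T" for t
      using that u min [of t] by (cases "t = v") auto
    then have "first (insert u T) = v" using u T v by (intro first_eqI) auto
    moreover have "insert u T - {v} = insert u T'" using u v by (auto simp: T'_def)
    ultimately show "homotopy c (insert u T) = div_least v (c (insert u T'))" by (simp add: homotopy_def)
    \<comment> \<open>The additional element \<open>v\<close> of \<open>T\<close> precedes
      \<open>u\<close> and contributes one factor -1.\<close>
    show "sg u T = - sg u T'" using u sg_insert [OF finT(2) T'(2), of u] by (simp add: T')
  qed
  have "boundary (homotopy c) T
    = (\<Sum>u\<in>?L. smul (single 0 (sg u T)) (smul (var u) (homotopy c (insert u T))))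
    + (\<Sum>u\<in>?G. smul (single 0 (sg u T)) (smul (var u) (homotopy c (insert u T))))"
    unfolding boundary_def split(1) using finite_V split(2) by (intro sum.union_disjoint) auto
  also have "(\<Sum>u\<in>?L. smul (single 0 (sg u T)) (smul (var u) (homotopy c (insert u T))))
    = (\<Sum>u\<in>?L. smul (var u) (div_least u (c T)))"
    by (intro sum.cong) (simp_all add: low)
  also have "(\<Sum>u\<in>?G. smul (single 0 (sg u T)) (smul (var u) (homotopy c (insert u T)))) = - S"
    unfolding S_def sum_negf [symmetric] by (intro sum.cong) (simp_all add: high single_uminus)
  also have "(\<Sum>u\<in>?L. smul (var u) (div_least u (c T))) + - S = c T"
    using sum_var_div_least [OF c v(2)] by (simp add: S)
  finally show ?thesis .
qed

lemma homotopy_free_module: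
  assumes "T \<subseteq> V" "T \<noteq> {}" "c (T - {first T}) \<in> free_module V r"
  shows "homotopy c T \<in> free_module V r"
  using assms by (simp add: homotopy_def div_least_free_module)

lemma boundary_minus: "boundary (\<lambda>T. f T - g T) T = boundary f T - boundary g T"
  by (simp add: boundary_def fvec.scale_right_diff_distrib sum_subtractf)

lemma boundary_in_submodule:
  assumes "submodule_over V N" "\<And>v. v \<in> V - T \<Longrightarrow> c (insert v T) \<in> N"
  shows "boundary c T \<in> N"
  unfolding boundary_def
  by (intro submodule_over_sum [OF assms(1)] submodule_overD(3) [OF assms(1)] poly_ring_closed assms(2)) auto

lemma homogeneous_boundary:
  assumes "\<And>v. v \<in> V - T \<Longrightarrow> fvec_homogeneous n (c (insert v T))"
  shows "fvec_homogeneous (Suc n) (boundary c T)"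
  unfolding boundary_def by (intro homogeneous_sum homogeneous_scale homogeneous_var assms)

lemma graded_map_boundary:
  assumes \<phi>: "graded_map V r r' \<phi>" and c: "\<And>v. v \<in> V - T \<Longrightarrow> c (insert v T) \<in> free_module V r"
  shows "\<phi> (boundary c T) = boundary (\<lambda>T. \<phi> (c T)) T"
  unfolding boundary_def
  by (subst graded_map_sum [OF \<phi>])
    (auto simp del: fvec.scale_scale simp: graded_mapD(3) [OF \<phi>] c poly_ring_closed submodule_overD [OF submodule_free_module]
      intro!: sum.cong)

text \<open>\<open>c\<close> represents a nonzero class of internal degree \<open>d\<close> in the \<open>p\<close>-th Koszul homology of \<open>A / J\<close>.\<close>

definition koszul_class ::
  "('v, 'k::field) fvec set \<Rightarrow> ('v, 'k) fvec set \<Rightarrow> nat \<Rightarrow> nat \<Rightarrow> ('v set \<Rightarrow> ('v, 'k) fvec) \<Rightarrow> bool" where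
  "koszul_class A J p d c \<longleftrightarrow>
     (\<forall>T\<subseteq>V. card T = p \<longrightarrow> c T \<in> A \<and> fvec_homogeneous (d - p) (c T))
     \<and> (\<forall>T\<subseteq>V. Suc (card T) = p \<longrightarrow> boundary c T \<in> J)
     \<and> \<not> (\<exists>u. (\<forall>T\<subseteq>V. card T = Suc p \<longrightarrow> u T \<in> A) \<and> (\<forall>T\<subseteq>V. card T = p \<longrightarrow> c T - boundary u T \<in> J))"

lemma card_insert_V: "T \<subseteq> V \<Longrightarrow> v \<in> V - T \<Longrightarrow> insert v T \<subseteq> V \<and> card (insert v T) = Suc (card T)"
  using finite_subset [OF _ finite_V, of T] by auto

text \<open>The component of degree \<open>n\<close> of any lift is again a lift, because
  \<open>\<phi>\<close> commutes with components and \<open>J\<close> is closed under them.\<close>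

lemma homogeneous_lift:
  assumes \<phi>: "graded_map V r r' \<phi>" and J: "graded_submodule V J"
    and surj: "\<And>a. a \<in> A \<Longrightarrow> \<exists>f\<in>free_module V r. a - \<phi> f \<in> J"
    and a: "a \<in> A" "fvec_homogeneous n a"
  shows "\<exists>f\<in>free_module V r. fvec_homogeneous n f \<and> a - \<phi> f \<in> J"
proof -
  obtain f where f: "f \<in> free_module V r" "a - \<phi> f \<in> J" using surj a by blast
  then have "component n (a - \<phi> f) \<in> J" using J by (auto simp: graded_submodule_def)
  then have "a - \<phi> (component n f) \<in> J"
    by (simp add: component_minus component_homogeneous [OF a(2)] graded_map_component [OF \<phi> f(1)])
  then show ?thesis using f component_free_module homogeneous_component by blast
qed

text \<open>The connecting homomorphism of Koszul homology for $0 \to N \to F \to A/J \to 0$ is injective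
  in positive degrees, since the free module \<open>F\<close> has no Koszul homology there.\<close>

lemma koszul_class_step:
  assumes \<phi>: "graded_map V r r' \<phi>" and J: "graded_submodule V J"
    and into: "\<And>f. f \<in> free_module V r \<Longrightarrow> \<phi> f \<in> A"
    and surj: "\<And>a. a \<in> A \<Longrightarrow> \<exists>f\<in>free_module V r. a - \<phi> f \<in> J"
    and c: "koszul_class A J (Suc p) d c" and d: "Suc p \<le> d"
  shows "\<exists>c'. koszul_class {f \<in> free_module V r. \<phi> f \<in> J} {0} p d c'"
proof -
  note F = submodule_free_module [of V r]
  have JS: "submodule_over V J" using J by (simp add: graded_submodule_def)
  have "\<forall>T. \<exists>f. T \<subseteq> V \<and> card T = Suc p \<longrightarrow>
      f \<in> free_module V r \<and> fvec_homogeneous (d - Suc p) f \<and> c T - \<phi> f \<in> J"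
  proof
    fix T
    show "\<exists>f. T \<subseteq> V \<and> card T = Suc p \<longrightarrow>
      f \<in> free_module V r \<and> fvec_homogeneous (d - Suc p) f \<and> c T - \<phi> f \<in> J"
    proof (cases "T \<subseteq> V \<and> card T = Suc p")
      case True
      then have "c T \<in> A" "fvec_homogeneous (d - Suc p) (c T)"
        using c by (auto simp: koszul_class_def)
      then show ?thesis using homogeneous_lift [OF \<phi> J surj] by blast
    qed auto
  qed
  then obtain l where l: "l T \<in> free_module V r" "fvec_homogeneous (d - Suc p) (l T)" "c T - \<phi> (l T) \<in> J"
    if "T \<subseteq> V" "card T = Suc p" for T by metis
  have li: "l (insert v T) \<in> free_module V r" "fvec_homogeneous (d - Suc p) (l (insert v T))"
    "c (insert v T) - \<phi> (l (insert v T)) \<in> J"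
    if "T \<subseteq> V" "card T = p" "v \<in> V - T" for v T
    using l [of "insert v T"] card_insert_V [OF that(1,3)] that by auto
  have lF: "boundary l T \<in> free_module V r" if "T \<subseteq> V" "card T = p" for T
    using that li by (intro boundary_in_submodule [OF F])
  \<comment> \<open>The connecting homomorphism: lift the chain to the free module and take the
    boundary of the lift.\<close>
  have "koszul_class {f \<in> free_module V r. \<phi> f \<in> J} {0} p d (boundary l)"
    unfolding koszul_class_def
  proof (intro conjI allI impI notI)
    fix T assume T: "T \<subseteq> V" "card T = p"
    have "fvec_homogeneous (Suc (d - Suc p)) (boundary l T)"
      using li T by (intro homogeneous_boundary)
    \<comment> \<open>Subtraction is truncated, so \<open>Suc p \<le> d\<close> is what makes the
      degree rise by one.\<close>
    then show "fvec_homogeneous (d - p) (boundary l T)" using d by (simp add: Suc_diff_Suc)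
    have "boundary (\<lambda>T. c T - \<phi> (l T)) T \<in> J"
      using li T by (intro boundary_in_submodule [OF JS])
    then have "boundary c T - \<phi> (boundary l T) \<in> J"
      using li(1) T by (subst graded_map_boundary [OF \<phi>]) (auto simp only: boundary_minus)
    moreover have "boundary c T \<in> J" using c T by (auto simp: koszul_class_def)
    ultimately have "boundary c T - (boundary c T - \<phi> (boundary l T)) \<in> J"
      using submodule_over_minus [OF JS] by blast
    then show "boundary l T \<in> {f \<in> free_module V r. \<phi> f \<in> J}" using lF T by simp
  next
    fix T assume "T \<subseteq> V" then show "boundary (boundary l) T \<in> {0}" by (simp add: boundary_boundary)
  next
    assume "\<exists>u. (\<forall>T\<subseteq>V. card T = Suc p \<longrightarrow> u T \<in> {f \<in> free_module V r. \<phi> f \<in> J}) \<and>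
        (\<forall>T\<subseteq>V. card T = p \<longrightarrow> boundary l T - boundary u T \<in> {0})"
    then obtain u where u: "\<And>T. T \<subseteq> V \<Longrightarrow> card T = Suc p \<Longrightarrow> u T \<in> free_module V r \<and> \<phi> (u T) \<in> J"
      "\<And>T. T \<subseteq> V \<Longrightarrow> card T = p \<Longrightarrow> boundary l T = boundary u T" by auto
    \<comment> \<open>If the new class bounded, \<open>e\<close> would be a cycle in the free
      module, hence the boundary of \<open>homotopy e\<close>. Applying \<open>\<phi>\<close> shows
      that \<open>c\<close> bounds modulo \<open>J\<close>, since \<open>\<phi> (u T)\<close> lies
      in \<open>J\<close>.\<close>
    define e where "e T = l T - u T" for T
    have e: "e T \<in> free_module V r" if "T \<subseteq> V" "card T = Suc p" for T
      using that l u by (auto simp: e_def intro: submodule_over_minus [OF F])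
    have hF: "homotopy e T \<in> free_module V r" if T: "T \<subseteq> V" "card T = Suc (Suc p)" for T
    proof -
      have "T \<noteq> {}" using T by auto
      moreover have "finite T" using T finite_V finite_subset by blast
      ultimately show ?thesis using T first(1) [of T]
        by (intro homotopy_free_module e) auto
    qed
    have "c T - boundary (\<lambda>T. \<phi> (homotopy e T)) T \<in> J" if T: "T \<subseteq> V" "card T = Suc p" for T
    proof -
      have ne: "T \<noteq> {}" "finite T" using T finite_V finite_subset by auto
      then have "boundary e (T - {first T}) = 0"
        using T first(1) [of T] u(2) [of "T - {first T}"] unfolding e_def boundary_minus by auto
      then have "boundary (homotopy e) T = l T - u T"
        using T ne e [OF T] by (subst boundary_homotopy) (auto simp: e_def)
      then have "boundary (\<lambda>T. \<phi> (homotopy e T)) T = \<phi> (l T - u T)"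
        using hF [of "insert _ T"] card_insert_V [OF T(1)] T(2)
        by (subst graded_map_boundary [OF \<phi>, symmetric]) auto
      also have "\<dots> = \<phi> (l T) - \<phi> (u T)" using l u T by (intro graded_map_minus [OF \<phi>]) auto
      finally have "c T - boundary (\<lambda>T. \<phi> (homotopy e T)) T = (c T - \<phi> (l T)) + \<phi> (u T)" by simp
      then show ?thesis
        using submodule_overD(2) [OF JS l(3) [OF T], of "\<phi> (u T)"] u(1) [OF T] by metis
    qed
    moreover have "\<forall>T\<subseteq>V. card T = Suc (Suc p) \<longrightarrow> \<phi> (homotopy e T) \<in> A"
      using hF into by blast
    ultimately have "\<exists>w. (\<forall>T\<subseteq>V. card T = Suc (Suc p) \<longrightarrow> w T \<in> A)
        \<and> (\<forall>T\<subseteq>V. card T = Suc p \<longrightarrow> c T - boundary w T \<in> J)"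
      by (intro exI [of _ "\<lambda>T. \<phi> (homotopy e T)"]) simp
    then show False
      using c by (simp add: koszul_class_def)
  qed
  then show ?thesis by blast
qed

text \<open>In Koszul degree 0 a nonzero class is an element of A/J outside m(A/J). If no basis
  element had degree \<open>d\<close>, a lift of degree \<open>d\<close> would have no constant
  coefficient, so it would lie in m F and its image would bound.\<close>

lemma koszul_class_generator:
  assumes \<phi>: "graded_map V r r' \<phi>" and J: "graded_submodule V J"
    and into: "\<And>f. f \<in> free_module V r \<Longrightarrow> \<phi> f \<in> A"
    and surj: "\<And>a. a \<in> A \<Longrightarrow> \<exists>f\<in>free_module V r. a - \<phi> f \<in> J"
    and c: "koszul_class A J 0 d c"
  shows "r d \<noteq> 0"
proof
  assume r: "r d = 0"
  have "c {} \<in> A" "fvec_homogeneous d (c {})" using c by (auto simp: koszul_class_def)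
  then obtain f where f: "f \<in> free_module V r" "fvec_homogeneous d f" "c {} - \<phi> f \<in> J"
    using homogeneous_lift [OF \<phi> J surj] by blast
  have "coef f b 0 = 0" for b
    using homogeneousD [OF f(2), of b 0] free_moduleD [OF f(1), of b 0] r by (auto simp: mon_degree_def)
  then have "f = (\<Sum>v\<in>V. smul (var v) (div_least v f))"
    using sum_var_div_least_all [OF f(1)] by simp
  then have "\<phi> f = \<phi> (\<Sum>v\<in>V. smul (var v) (div_least v f))" by simp
  also have "\<dots> = (\<Sum>v\<in>V. \<phi> (smul (var v) (div_least v f)))"
    using f by (intro graded_map_sum [OF \<phi>] submodule_overD(3) [OF submodule_free_module] div_least_free_module poly_ring_closed)
  \<comment> \<open>A 1-chain lives on singletons, from which \<open>the_elem\<close> recovers the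
    variable; the signs over the empty set are 1.\<close>
  also have "\<dots> = boundary (\<lambda>T. \<phi> (div_least (the_elem T) f)) {}"
    unfolding boundary_def using f
    by (intro sum.cong) (auto simp: sg_def div_least_free_module graded_mapD(3) [OF \<phi>] poly_ring_closed)
  finally have "\<forall>T\<subseteq>V. card T = 0 \<longrightarrow> c T - boundary (\<lambda>T. \<phi> (div_least (the_elem T) f)) T \<in> J"
    using f(3) finite_V by (auto dest: finite_subset)
  moreover have "\<forall>T\<subseteq>V. card T = Suc 0 \<longrightarrow> \<phi> (div_least (the_elem T) f) \<in> A"
    using f into div_least_free_module by blast
  ultimately have "\<exists>w. (\<forall>T\<subseteq>V. card T = Suc 0 \<longrightarrow> w T \<in> A)
      \<and> (\<forall>T\<subseteq>V. card T = 0 \<longrightarrow> c T - boundary w T \<in> J)"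
    by (intro exI [of _ "\<lambda>T. \<phi> (div_least (the_elem T) f)"]) simp
  then show False using c by (simp add: koszul_class_def)
qed

end

section \<open>Cyclic modules\<close>

text \<open>The ranks of S over itself: S/I is thus handled by the same notions as the syzygy
  modules.\<close>

definition rank_one :: "nat \<Rightarrow> nat" where
  "rank_one a = (if a = 0 then 1 else 0)"

definition emb :: "('v, 'k::field) mpoly \<Rightarrow> ('v, 'k) fvec" where
  "emb p = single (0, 0) p"

lemma coef_emb: "coef (emb p) c m = (if c = (0, 0) then lookup p m else 0)"
  by (auto simp: coef_def emb_def lookup_single when_def)

lemma emb_add: "emb (p + q) = emb p + emb q"
  by (simp add: emb_def single_add)

lemma emb_minus: "emb (p - q) = emb p - emb q"
  by (simp add: emb_def single_diff)

lemma emb_0 [simp]: "emb 0 = 0"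
  by (simp add: emb_def)

lemma emb_smul: "smul p (emb q) = emb (p * q)"
  by (rule poly_mapping_eqI) (auto simp: emb_def lookup_single when_def)

lemma emb_in_iff [simp]: "emb p \<in> emb ` I \<longleftrightarrow> p \<in> I"
  by (auto simp: emb_def dest: injD [OF inj_single])

lemma emb_free_module: "emb p \<in> free_module V rank_one \<longleftrightarrow> p \<in> poly_ring V"
  by (auto simp: free_module_iff coef_emb rank_one_def poly_ring_def in_keys_iff)

lemma free_module_rank_one:
  "free_module V rank_one = (emb ` poly_ring V :: ('v, 'k::field) fvec set)"
proof -
  have "f = emb (lookup f (0, 0))" if f: "f \<in> free_module V rank_one" for f :: "('v, 'k) fvec"
  proof (rule fvec_eqI)
    fix c m
    have "coef f c m = 0" if "c \<noteq> (0, 0)"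
    proof (rule ccontr)
      assume "coef f c m \<noteq> 0"
      then show False
        using free_moduleD [OF f, of c m] that by (cases c) (auto simp: rank_one_def split: if_splits)
    qed
    then show "coef f c m = coef (emb (lookup f (0, 0))) c m"
      by (cases "c = (0, 0)") (simp_all add: coef_emb, simp add: coef_def)
  qed
  then show ?thesis by (auto simp: emb_free_module intro: free_module_lookup)
qed

lemma homogeneous_emb: "fvec_homogeneous n (emb p) \<longleftrightarrow> homogeneous n p"
  by (auto simp: fvec_homogeneous_iff coef_emb homogeneous_def in_keys_iff)

text \<open>At every stage \<open>\<phi> q\<close> maps F_q onto \<open>A q\<close> modulo
  \<open>J q\<close>: the quotient is S/I for q = 0 and the q-th syzygy module afterwards. Each
  connecting homomorphism lowers the Koszul degree by one and keeps \<open>n\<close>, so after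
  \<open>i\<close> of them a class in Koszul degree 0 forces a generator of F_i in degree
  \<open>n\<close>.\<close>

lemma (in ordered_variables) betti_nonzero_if_koszul_class:
  assumes res: "minimal_graded_free_resolution V I b d \<epsilon>"
    and I: "graded_submodule V (emb ` I)"
    and c: "koszul_class (free_module V rank_one) (emb ` I) i n c" and "i \<le> n"
  shows "b i n \<noteq> 0"
proof -
  \<comment> \<open>\<open>r q\<close> gives the ranks of the free module that contains
    \<open>A q\<close>. The shift by one puts the augmentation on the same footing as the
    differentials.\<close>
  define r where "r q = (case q of 0 \<Rightarrow> rank_one | Suc k \<Rightarrow> b k)" for q
  define \<phi> where "\<phi> q = (case q of 0 \<Rightarrow> \<lambda>f. emb (\<epsilon> f) | Suc k \<Rightarrow> d k)" for q
  define J where "J q = (case q of 0 \<Rightarrow> emb ` I | Suc k \<Rightarrow> {0})" for q :: nat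
  define A where "A q = (case q of 0 \<Rightarrow> free_module V rank_one | Suc k \<Rightarrow> {f \<in> free_module V (b k). \<phi> k f \<in> J k})" for q
  have map: "graded_map V (b q) (r q) (\<phi> q)" for q
    using res by (cases q) (auto simp: minimal_graded_free_resolution_def r_def \<phi>_def graded_linear_def
        emb_free_module homogeneous_emb emb_add emb_smul)
  have J: "graded_submodule V (J q)" for q
    using I by (cases q) (auto simp: J_def)
  have image: "\<phi> (Suc q) ` free_module V (b (Suc q)) = A (Suc q)" for q
    using res by (cases q) (auto simp: minimal_graded_free_resolution_def A_def \<phi>_def J_def)
  have into: "\<phi> q f \<in> A q" if "f \<in> free_module V (b q)" for q f
  proof (cases q)
    case 0
    then show ?thesis using graded_mapD(1) [OF map that] by (simp add: A_def r_def)
  next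
    case (Suc k)
    then show ?thesis using image that by auto
  qed
  have surj: "\<exists>f\<in>free_module V (b q). a - \<phi> q f \<in> J q" if a: "a \<in> A q" for q a
  proof (cases q)
    case 0
    then obtain p where p: "a = emb p" "p \<in> poly_ring V" using a by (auto simp: A_def free_module_rank_one)
    then obtain f where "f \<in> free_module V (b 0)" "p - \<epsilon> f \<in> I"
      using res by (auto simp: minimal_graded_free_resolution_def)
    then show ?thesis using 0 p by (auto simp: \<phi>_def J_def emb_minus [symmetric])
  next
    case (Suc k)
    then obtain f where "f \<in> free_module V (b q)" "a = \<phi> q f" using a image by auto
    then show ?thesis using Suc by (auto simp: J_def)
  qed
  have "\<exists>c. koszul_class (A q) (J q) (i - q) n c" if "q \<le> i" for q
    using that
  proof (induction q)
    case 0
    then show ?case using c by (auto simp: A_def J_def)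
  next
    case (Suc q)
    then obtain c where "koszul_class (A q) (J q) (Suc (i - Suc q)) n c"
      by (auto simp: Suc_diff_Suc)
    then have "\<exists>c. koszul_class {f \<in> free_module V (b q). \<phi> q f \<in> J q} {0} (i - Suc q) n c"
      using Suc.prems \<open>i \<le> n\<close> by (intro koszul_class_step [OF map J into surj]) auto
    then show ?case by (simp add: A_def J_def)
  qed
  then obtain c where "koszul_class (A i) (J i) 0 n c" by fastforce
  with map J into surj show ?thesis by (rule koszul_class_generator)
qed

section \<open>Existence of minimal graded free resolutions\<close>

text \<open>A basis modulo \<open>P\<close> without a quotient space: among the finite subsets of
  \<open>N\<close> that generate it modulo \<open>P\<close>, one of least size is independent, as a
  relation would allow an element to be dropped. The numbering below \<open>r\<close> matches the
  basis of \<open>free_module\<close>.\<close>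

lemma (in vector_space) minimal_generators_modulo:
  assumes P: "subspace P" and N: "subspace N" and B: "finite B" "N \<subseteq> span B"
  shows "\<exists>r (g :: nat \<Rightarrow> 'b). (\<forall>k<r. g k \<in> N)
    \<and> (\<forall>x\<in>N. \<exists>c. x - (\<Sum>k<r. c k *s g k) \<in> P)
    \<and> (\<forall>c. (\<Sum>k<r. c k *s g k) \<in> P \<longrightarrow> (\<forall>k<r. c k = 0))"
proof -
  define gen where "gen G \<longleftrightarrow> finite G \<and> G \<subseteq> N \<and> (\<forall>x\<in>N. \<exists>c. x - (\<Sum>g\<in>G. c g *s g) \<in> P)" for G
  obtain C where C: "C \<subseteq> N" "independent C" "N \<subseteq> span C" using maximal_independent_subset .
  have finC: "finite C" using independent_span_bound [OF B(1) C(2)] C B by auto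
  have "gen C" unfolding gen_def
  proof (intro conjI ballI)
    fix x assume "x \<in> N"
    then obtain c where "x = (\<Sum>g\<in>C. c g *s g)" using C(3) finC by (auto simp: span_finite)
    then show "\<exists>c. x - (\<Sum>g\<in>C. c g *s g) \<in> P" using subspace_0 [OF P] by (intro exI [of _ c]) simp
  qed (use C finC in auto)
  then obtain G where G: "gen G" and min: "\<And>H. gen H \<Longrightarrow> card G \<le> card H"
    using ex_has_least_nat [of gen C card] by blast
  have finG: "finite G" using G by (simp add: gen_def)
  have indep: "c g = 0" if c: "(\<Sum>g\<in>G. c g *s g) \<in> P" and g: "g \<in> G" for c g
  proof (rule ccontr)
    assume nz: "c g \<noteq> 0"
    have "gen (G - {g})" unfolding gen_def
    proof (intro conjI ballI)
      fix x assume "x \<in> N"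
      then obtain e where e: "x - (\<Sum>h\<in>G. e h *s h) \<in> P" using G by (auto simp: gen_def)
      \<comment> \<open>Adding this multiple of the relation cancels the coefficient at
        \<open>g\<close>.\<close>
      define k where "k = e g / c g"
      have "x - (\<Sum>h\<in>G. e h *s h) + k *s (\<Sum>h\<in>G. c h *s h) \<in> P"
        using e c P by (intro subspace_add subspace_scale)
      also have "x - (\<Sum>h\<in>G. e h *s h) + k *s (\<Sum>h\<in>G. c h *s h) = x - (\<Sum>h\<in>G. (e h - k * c h) *s h)"
        by (simp add: scale_sum_right scale_left_diff_distrib sum_subtractf)
      also have "\<dots> = x - (\<Sum>h\<in>G - {g}. (e h - k * c h) *s h)"
        using sum.remove [OF finG g, of "\<lambda>h. (e h - k * c h) *s h"] nz by (simp add: k_def)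
      finally show "\<exists>c. x - (\<Sum>h\<in>G - {g}. c h *s h) \<in> P"
        by (rule exI [of _ "\<lambda>h. e h - k * c h"])
    qed (use G in \<open>auto simp: gen_def\<close>)
    then show False using min [of "G - {g}"] card_Diff1_less [OF finG g] by simp
  qed
  obtain h where h: "bij_betw h {..<card G} G"
    using ex_bij_betw_nat_finite [OF finG] by (auto simp: atLeast0LessThan)
  note reindex = sum.reindex_bij_betw [OF h]
  show ?thesis
  proof (intro exI [of _ "card G"] exI [of _ h] conjI allI ballI impI)
    fix k assume "k < card G"
    then show "h k \<in> N" using G h by (auto simp: gen_def bij_betw_def)
  next
    fix x assume "x \<in> N"
    then obtain c where "x - (\<Sum>g\<in>G. c g *s g) \<in> P" using G by (auto simp: gen_def)
    then show "\<exists>c. x - (\<Sum>k<card G. c k *s h k) \<in> P"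
      by (intro exI [of _ "\<lambda>k. c (h k)"]) (simp add: reindex [of "\<lambda>g. c g *s g"])
  next
    fix c k assume c: "(\<Sum>k<card G. c k *s h k) \<in> P" and k: "k < card G"
    define i where "i = the_inv_into {..<card G} h"
    have i: "i (h k) = k" if "k < card G" for k
      using h that by (simp add: i_def bij_betw_def the_inv_into_f_f)
    have "(\<Sum>g\<in>G. c (i g) *s g) = (\<Sum>k<card G. c k *s h k)"
      by (subst reindex [symmetric]) (simp add: i)
    then have "c (i (h k)) = 0" using c k h by (intro indep) (auto simp: bij_betw_def)
    then show "c k = 0" using i k by simp
  qed
qed

lemma finite_monomials: "finite V \<Longrightarrow> finite {m :: 'v \<Rightarrow>\<^sub>0 nat. keys m \<subseteq> V \<and> mon_degree m \<le> n}"
proof (rule finite_imageD)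
  assume V: "finite V"
  have "lookup ` {m :: 'v \<Rightarrow>\<^sub>0 nat. keys m \<subseteq> V \<and> mon_degree m \<le> n}
      \<subseteq> {g. \<forall>x. (x \<in> V \<longrightarrow> g x \<in> {..n}) \<and> (x \<notin> V \<longrightarrow> g x = 0)}"
  proof clarsimp
    fix m :: "'v \<Rightarrow>\<^sub>0 nat" and x assume m: "keys m \<subseteq> V" "mon_degree m \<le> n"
    have "lookup m x \<le> mon_degree m" if "x \<in> V"
      using that V by (simp add: mon_degree_superset [OF V m(1)] member_le_sum)
    then show "(x \<in> V \<longrightarrow> lookup m x \<le> n) \<and> (x \<notin> V \<longrightarrow> lookup m x = 0)"
      using m by (auto simp: in_keys_iff)
  qed
  then show "finite (lookup ` {m :: 'v \<Rightarrow>\<^sub>0 nat. keys m \<subseteq> V \<and> mon_degree m \<le> n})"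
    by (rule finite_subset) (rule finite_set_of_finite_funs [OF V], simp)
qed (auto intro!: inj_onI poly_mapping_eqI)

text \<open>A term of degree \<open>n\<close> involves a basis element of degree at most
  \<open>n\<close> and a monomial of degree at most \<open>n\<close>. There are finitely many of
  both, even if the total rank is infinite.\<close>

lemma finite_spanning_homogeneous:
  assumes V: "finite V"
  shows "\<exists>B :: ('v, 'k::field) fvec set. finite B
    \<and> {f \<in> free_module V r. fvec_homogeneous n f} \<subseteq> fvec_space.span B"
proof (intro exI conjI)
  define unit :: "nat \<times> nat \<Rightarrow> ('v \<Rightarrow>\<^sub>0 nat) \<Rightarrow> ('v, 'k) fvec"
    where "unit c m = single c (single m 1)" for c m
  have unit: "coef (unit c m) c' m' = (if c = c' \<and> m = m' then 1 else 0)" for c m c' m'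
    by (auto simp: unit_def coef_def lookup_single when_def)
  let ?B = "case_prod unit ` (Sigma {..n} (\<lambda>a. {..<r a}) \<times> {m. keys m \<subseteq> V \<and> mon_degree m \<le> n})"
  show "finite ?B" using finite_monomials [OF V] by auto
  show "{f \<in> free_module V r. fvec_homogeneous n f} \<subseteq> fvec_space.span ?B"
  proof clarify
    fix f :: "('v, 'k) fvec" assume f: "f \<in> free_module V r" "fvec_homogeneous n f"
    have "f = (\<Sum>c\<in>keys f. \<Sum>m\<in>keys (lookup f c). smul (single 0 (coef f c m)) (unit c m))"
    proof (rule fvec_eqI)
      fix c m
      have "coef (\<Sum>c\<in>keys f. \<Sum>m\<in>keys (lookup f c). smul (single 0 (coef f c m)) (unit c m)) c m
        = (\<Sum>c'\<in>keys f. if c' = c then coef f c m else 0)"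
        unfolding coef_sum coef_scale unit
        by (intro sum.cong) (auto simp: coef_def in_keys_iff if_distrib cong: if_cong)
      also have "\<dots> = coef f c m" by (auto simp: coef_def in_keys_iff)
      finally show "coef f c m
        = coef (\<Sum>c\<in>keys f. \<Sum>m\<in>keys (lookup f c). smul (single 0 (coef f c m)) (unit c m)) c m" ..
    qed
    also have "\<dots> \<in> fvec_space.span ?B"
    proof (intro fvec_space.span_sum fvec_space.span_scale fvec_space.span_base)
      fix c m assume "m \<in> keys (lookup f c)"
      then have "coef f c m \<noteq> 0" by (simp add: coef_def in_keys_iff)
      then have "snd c < r (fst c)" "keys m \<subseteq> V" "mon_degree m + fst c = n"
        using free_moduleD [OF f(1)] homogeneousD [OF f(2)] by blast+
      then show "unit c m \<in> ?B"
        by (intro image_eqI [of _ _ "(c, m)"]) (auto simp: mem_Times_iff, auto simp: mem_Sigma_iff [of "fst c" "snd c", simplified])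
    qed
    finally show "f \<in> fvec_space.span ?B" .
  qed
qed

section \<open>Minimal free covers\<close>

lemma homogeneous_smul:
  assumes p: "\<And>m. m \<in> keys p \<Longrightarrow> mon_degree m + a = n" and g: "fvec_homogeneous a g"
  shows "fvec_homogeneous n (smul p g)"
  unfolding fvec_homogeneous_iff
proof (intro allI impI)
  fix c m assume "coef (smul p g) c m \<noteq> 0"
  then have "m \<in> keys (p * lookup g c)" by (simp add: coef_def in_keys_iff)
  then obtain m1 m2 where m: "m = m1 + m2" "m1 \<in> keys p" "m2 \<in> keys (lookup g c)"
    using keys_mult [of p "lookup g c"] by blast
  then have "mon_degree m2 + fst c = a" using homogeneousD [OF g, of c m2] by (simp add: coef_def in_keys_iff)
  then show "mon_degree m + fst c = n" using p [OF m(2)] by (simp add: m mon_degree_add)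
qed

lemma submodule_image:
  assumes \<phi>: "graded_map V r r' \<phi>"
  shows "submodule_over V (\<phi> ` free_module V r)"
  unfolding submodule_over_def
proof (intro conjI ballI)
  show "0 \<in> \<phi> ` free_module V r"
    using graded_map_0 [OF \<phi>] submodule_overD(1) [OF submodule_free_module] by (metis image_eqI)
qed (auto simp: graded_mapD(2,3) [OF \<phi>, symmetric] submodule_overD [OF submodule_free_module])

context ordered_variables
begin

text \<open>\<open>max\<close> refers to the maximal ideal m: this is the part of m N in degree
  \<open>n\<close>, written with coefficients of degree \<open>n - 1\<close> so that induction on
  the degree applies to them. In degree 0 only the zero vector remains.\<close>

definition max_part :: "('v, 'k::field) fvec set \<Rightarrow> nat \<Rightarrow> ('v, 'k) fvec set" where
  "max_part N n = {f. f = 0 \<or> (\<exists>k y. n = Suc k \<and> f = (\<Sum>v\<in>V. smul (var v) (y v))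
     \<and> (\<forall>v\<in>V. y v \<in> N \<and> fvec_homogeneous k (y v)))}"

lemma max_partI:
  "f = (\<Sum>v\<in>V. smul (var v) (y v)) \<Longrightarrow> \<forall>v\<in>V. y v \<in> N \<and> fvec_homogeneous k (y v)
    \<Longrightarrow> f \<in> max_part N (Suc k)"
  unfolding max_part_def by auto

lemma subspace_max_part:
  assumes N: "submodule_over V N"
  shows "fvec_space.subspace (max_part N n)"
proof (rule fvec_space.subspaceI)
  fix f g assume fg: "f \<in> max_part N n" "g \<in> max_part N n"
  show "f + g \<in> max_part N n"
  proof (cases "f = 0 \<or> g = 0")
    case True
    then show ?thesis using fg by auto
  next
    case False
    then obtain k y z where *: "n = Suc k" "f = (\<Sum>v\<in>V. smul (var v) (y v))" "g = (\<Sum>v\<in>V. smul (var v) (z v))"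
      "\<forall>v\<in>V. y v \<in> N \<and> fvec_homogeneous k (y v)" "\<forall>v\<in>V. z v \<in> N \<and> fvec_homogeneous k (z v)"
      using fg by (auto simp: max_part_def)
    then have "f + g = (\<Sum>v\<in>V. smul (var v) (y v + z v))"
      by (simp add: fvec.scale_right_distrib sum.distrib)
    moreover have "\<forall>v\<in>V. y v + z v \<in> N \<and> fvec_homogeneous k (y v + z v)"
      using * by (auto intro: submodule_overD [OF N] homogeneous_add)
    ultimately show ?thesis unfolding *(1) by (rule max_partI)
  qed
next
  fix a f assume f: "f \<in> max_part N n"
  show "smul (single 0 a) f \<in> max_part N n"
  proof (cases "f = 0")
    case True
    then show ?thesis by (simp add: max_part_def)
  next
    case False
    then obtain k y where *: "n = Suc k" "f = (\<Sum>v\<in>V. smul (var v) (y v))"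
      "\<forall>v\<in>V. y v \<in> N \<and> fvec_homogeneous k (y v)"
      using f by (auto simp: max_part_def)
    then have "smul (single 0 a) f = (\<Sum>v\<in>V. smul (var v) (smul (single 0 a) (y v)))"
      by (simp add: fvec.scale_sum_right mult.commute)
    moreover have "\<forall>v\<in>V. smul (single 0 a) (y v) \<in> N \<and> fvec_homogeneous k (smul (single 0 a) (y v))"
      using * by (auto intro: submodule_overD [OF N] homogeneous_scale poly_ring_closed)
    ultimately show ?thesis unfolding *(1) by (rule max_partI)
  qed
qed (simp add: max_part_def)

text \<open>As \<open>a < n\<close>, \<open>p\<close> has no constant term. Splitting the least
  variable off each monomial moves a variable in front and leaves factors of degree one
  less.\<close>

lemma smul_in_max_part:
  assumes N: "submodule_over V N" and y: "y \<in> N" "fvec_homogeneous a y" and a: "a < n"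
    and p: "p \<in> poly_ring V" "\<And>m. m \<in> keys p \<Longrightarrow> mon_degree m + a = n"
  shows "smul p y \<in> max_part N n"
proof -
  obtain k where k: "n = Suc k" using a by (cases n) auto
  \<comment> \<open>Division acts on vectors, so \<open>p\<close> is viewed as a vector with one
    coordinate.\<close>
  define q where "q v = lookup (div_least v (emb p)) (0, 0)" for v
  have e: "emb p \<in> free_module V rank_one" using p by (simp add: emb_free_module)
  have "coef (emb p) c 0 = 0" for c
    using p(2) [of 0] a by (auto simp: coef_emb in_keys_iff mon_degree_def)
  then have "emb p = (\<Sum>v\<in>V. smul (var v) (div_least v (emb p)))"
    using sum_var_div_least_all [OF e] by simp
  then have "lookup (emb p) (0, 0) = lookup (\<Sum>v\<in>V. smul (var v) (div_least v (emb p))) (0, 0)" by simp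
  then have "p = (\<Sum>v\<in>V. var v * q v)"
    by (simp add: lookup_sum q_def, simp add: emb_def)
  then have "smul p y = (\<Sum>v\<in>V. smul (var v) (smul (q v) y))"
    by (metis (no_types, lifting) fvec.scale_scale fvec.scale_sum_left sum.cong)
  moreover have "\<forall>v\<in>V. smul (q v) y \<in> N \<and> fvec_homogeneous k (smul (q v) y)"
  proof (intro ballI conjI)
    fix v
    show "smul (q v) y \<in> N"
      using y free_module_lookup [OF div_least_free_module [OF e]] by (auto simp: q_def intro: submodule_overD(3) [OF N])
    show "fvec_homogeneous k (smul (q v) y)"
    proof (rule homogeneous_smul [OF _ y(2)])
      fix m assume "m \<in> keys (q v)"
      then have "coef (div_least v (emb p)) (0, 0) m \<noteq> 0" by (simp add: q_def coef_def in_keys_iff)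
      then have "m + single v 1 \<in> keys p"
        by (auto simp: coef_div_least coef_emb in_keys_iff split: if_splits)
      then show "mon_degree m + a = k" using p(2) k by (fastforce simp: mon_degree_add)
    qed
  qed
  ultimately show ?thesis unfolding k by (rule max_partI)
qed

text \<open>In each degree \<open>n\<close> choose generators of \<open>N\<close> that form a basis modulo
  the part of $\mathfrak m N$ of degree \<open>n\<close>.\<close>

lemma minimal_free_cover:
  fixes N :: "('v, 'k::field) fvec set"
  assumes N: "graded_submodule V N" and NF: "N \<subseteq> free_module V r"
  shows "\<exists>r' \<phi>. graded_map V r' r \<phi> \<and> \<phi> ` free_module V r' = N
    \<and> (\<forall>f\<in>free_module V r'. \<phi> f = 0 \<longrightarrow> (\<forall>c. coef f c 0 = 0))"
proof -
  have NS: "submodule_over V N" and Nc: "\<And>n f. f \<in> N \<Longrightarrow> component n f \<in> N"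
    using N by (auto simp: graded_submodule_def)
  let ?N = "\<lambda>n. {f \<in> N. fvec_homogeneous n f}"
  define basis where "basis n r g \<longleftrightarrow> (\<forall>k<r. g k \<in> ?N n)
    \<and> (\<forall>x\<in>?N n. \<exists>c. x - (\<Sum>k<r. smul (single 0 (c k)) (g k)) \<in> max_part N n)
    \<and> (\<forall>c. (\<Sum>k<r. smul (single 0 (c k)) (g k)) \<in> max_part N n \<longrightarrow> (\<forall>k<r. c k = 0))"
    for n r and g :: "nat \<Rightarrow> ('v, 'k) fvec"
  have "\<exists>r g. basis n r g" for n
  proof -
    obtain B :: "('v, 'k) fvec set" where B: "finite B"
      "{f \<in> free_module V r. fvec_homogeneous n f} \<subseteq> fvec_space.span B"
      using finite_spanning_homogeneous [OF finite_V] by blast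
    have "fvec_space.subspace (?N n)"
      by (rule fvec_space.subspaceI)
        (auto intro: submodule_overD [OF NS] homogeneous_add homogeneous_scale poly_ring_closed)
    then show ?thesis
      unfolding basis_def using B NF
      by (intro fvec_space.minimal_generators_modulo [OF subspace_max_part [OF NS], of _ B]) auto
  qed
  then obtain r' g where basis: "\<And>n. basis n (r' n) (g n)" by metis
  have g: "\<And>n k. k < r' n \<Longrightarrow> g n k \<in> N \<and> fvec_homogeneous n (g n k)"
    and gen: "\<And>n x. x \<in> N \<Longrightarrow> fvec_homogeneous n x \<Longrightarrow>
      \<exists>c. x - (\<Sum>k<r' n. smul (single 0 (c k)) (g n k)) \<in> max_part N n"
    and indep: "\<And>n c k. (\<Sum>k<r' n. smul (single 0 (c k)) (g n k)) \<in> max_part N n \<Longrightarrow> k < r' n \<Longrightarrow> c k = 0"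
    using basis by (auto simp only: basis_def mem_Collect_eq)
  \<comment> \<open>The linear map that sends the basis element \<open>(n, k)\<close> to the
    generator \<open>g n k\<close>.\<close>
  define \<phi> where "\<phi> f = (\<Sum>c\<in>keys f. smul (lookup f c) (g (fst c) (snd c)))" for f
  have superset: "\<phi> f = (\<Sum>c\<in>K. smul (lookup f c) (g (fst c) (snd c)))" if "finite K" "keys f \<subseteq> K" for f K
    unfolding \<phi>_def using that by (intro sum.mono_neutral_left) (auto simp: in_keys_iff)
  have rank: "snd c < r' (fst c)" if "f \<in> free_module V r'" "c \<in> keys f" for f c
    using that by (cases c) (auto simp: free_module_def)
  have \<phi>N: "\<phi> f \<in> N" if "f \<in> free_module V r'" for f
    unfolding \<phi>_def using g rank [OF that] free_module_lookup [OF that]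
    by (intro submodule_over_sum [OF NS] submodule_overD(3) [OF NS]) auto
  have map: "graded_map V r' r \<phi>"
    unfolding graded_linear_def
  proof (intro conjI ballI allI impI)
    fix f h :: "('v, 'k) fvec"
    have "\<phi> (f + h) = (\<Sum>c\<in>keys f \<union> keys h. smul (lookup (f + h) c) (g (fst c) (snd c)))"
      using keys_add [of f h] by (intro superset) auto
    then show "\<phi> (f + h) = \<phi> f + \<phi> h"
      by (simp add: lookup_add fvec.scale_left_distrib sum.distrib superset [of "keys f \<union> keys h"])
  next
    fix p :: "('v, 'k) mpoly" and f :: "('v, 'k) fvec"
    have "\<phi> (smul p f) = (\<Sum>c\<in>keys f. smul (lookup (smul p f) c) (g (fst c) (snd c)))"
      by (intro superset) (auto simp: in_keys_iff)
    then show "\<phi> (smul p f) = smul p (\<phi> f)"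
      by (simp add: \<phi>_def fvec.scale_sum_right)
  next
    fix f :: "('v, 'k) fvec" and n assume f: "f \<in> free_module V r'" "fvec_homogeneous n f"
    have "fvec_homogeneous n (smul (lookup f c) (g (fst c) (snd c)))" if "c \<in> keys f" for c
      using g [OF rank [OF f(1) that]] homogeneousD [OF f(2), of c]
      by (intro homogeneous_smul [of _ "fst c"]) (auto simp: coef_def in_keys_iff)
    then show "fvec_homogeneous n (\<phi> f)" unfolding \<phi>_def by (rule homogeneous_sum)
  qed (use \<phi>N NF in auto)
  let ?im = "\<phi> ` free_module V r'"
  note im = submodule_image [OF map]
  have gim: "g n k \<in> ?im" if "k < r' n" for n k
  proof
    show "g n k = \<phi> (single (n, k) 1)" by (simp add: \<phi>_def)
    show "single (n, k) 1 \<in> free_module V r'"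
      using that by (auto simp: free_module_def lookup_single when_def poly_ring_closed)
  qed
  \<comment> \<open>Graded Nakayama: modulo chosen generators of degree \<open>n\<close>, an element
    of \<open>N\<close> is a combination of elements of degree \<open>n - 1\<close>, which are in
    the image by induction.\<close>
  have homim: "x \<in> ?im" if "x \<in> N" "fvec_homogeneous n x" for x n
    using that
  proof (induction n arbitrary: x)
    case (0 x)
    then obtain c where "x - (\<Sum>k<r' 0. smul (single 0 (c k)) (g 0 k)) \<in> max_part N 0"
      using gen by blast
    then have "x = (\<Sum>k<r' 0. smul (single 0 (c k)) (g 0 k))" by (simp add: max_part_def)
    moreover have "\<dots> \<in> ?im"
      by (intro submodule_over_sum [OF im] submodule_overD(3) [OF im] poly_ring_closed gim) auto
    ultimately show ?case by metis
  next
    case (Suc n x)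
    then obtain c where c: "x - (\<Sum>k<r' (Suc n). smul (single 0 (c k)) (g (Suc n) k)) \<in> max_part N (Suc n)"
      (is "x - ?s \<in> _") using gen by blast
    have "y \<in> ?im" if "y \<in> max_part N (Suc n)" for y
      using that Suc.IH submodule_overD(1) [OF im] unfolding max_part_def
      by (auto intro!: submodule_over_sum [OF im] submodule_overD(3) [OF im] poly_ring_closed)
    then have "x - ?s \<in> ?im" using c by blast
    moreover have "?s \<in> ?im"
      by (intro submodule_over_sum [OF im] submodule_overD(3) [OF im] poly_ring_closed gim) auto
    ultimately have "(x - ?s) + ?s \<in> ?im" by (rule submodule_overD(2) [OF im])
    then show ?case by simp
  qed
  have "x \<in> ?im" if "x \<in> N" for x
  proof -
    obtain K where "finite K" "x = (\<Sum>n\<in>K. component n x)" using sum_component by blast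
    moreover have "(\<Sum>n\<in>K. component n x) \<in> ?im"
      by (intro submodule_over_sum [OF im] homim [OF Nc [OF that] homogeneous_component])
    ultimately show ?thesis by metis
  qed
  then have image: "?im = N" using \<phi>N by blast
  \<comment> \<open>In degree \<open>n\<close>, a relation has constant coefficients at the
    generators of degree \<open>n\<close>. The generators of lower degree contribute an element of
    \<open>max_part N n\<close>, so independence modulo that space makes the constants
    vanish.\<close>
  have "coef f (n, k) 0 = 0" if f: "f \<in> free_module V r'" "\<phi> f = 0" for f n k
  proof (cases "k < r' n")
    case False
    then show ?thesis using free_moduleD [OF f(1), of "(n, k)" 0] by auto
  next
    case k: True
    define h where "h = component n f"
    have h: "h \<in> free_module V r'" "fvec_homogeneous n h" "\<phi> h = 0"
      using f graded_map_component [OF map f(1)]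
      by (simp_all add: h_def component_free_module homogeneous_component)
    have deg: "mon_degree m + fst c = n" if "m \<in> keys (lookup h c)" for m c
      using homogeneousD [OF h(2), of c m] that by (simp add: coef_def in_keys_iff)
    let ?t = "\<lambda>c. smul (lookup h c) (g (fst c) (snd c))"
    let ?K = "{c \<in> keys h. fst c = n}" and ?L = "{c \<in> keys h. fst c \<noteq> n}"
    have "?t c \<in> max_part N n" if c: "c \<in> ?L" for c
    proof (rule smul_in_max_part [OF NS, of _ "fst c"])
      obtain m where m: "m \<in> keys (lookup h c)"
        using c by (metis (mono_tags, lifting) equals0I in_keys_iff keys_eq_empty mem_Collect_eq)
      then show "fst c < n" using deg [OF m] c by auto
    qed (use c g rank [OF h(1)] deg free_module_lookup [OF h(1)] in auto)
    then have L: "sum ?t ?L \<in> max_part N n"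
      by (intro fvec_space.subspace_sum [OF subspace_max_part [OF NS]])
    have "0 = sum ?t (?K \<union> ?L)" using h(3) by (simp add: \<phi>_def Un_def conj_disj_distribL [symmetric])
    also have "\<dots> = sum ?t ?K + sum ?t ?L" by (intro sum.union_disjoint) auto
    finally have "sum ?t ?K = - sum ?t ?L" by (simp add: eq_neg_iff_add_eq_0)
    then have K: "sum ?t ?K \<in> max_part N n"
      using fvec_space.subspace_neg [OF subspace_max_part [OF NS] L] by simp
    have const: "lookup h (n, k) = single 0 (coef f (n, k) 0)" for k
    proof (rule poly_mapping_eqI)
      fix m
      have "coef h (n, k) m = (if m = 0 then coef f (n, k) 0 else 0)"
        by (auto simp: h_def coef_component)
      then show "lookup (lookup h (n, k)) m = lookup (single 0 (coef f (n, k) 0)) m"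
        by (simp add: coef_def lookup_single when_def)
    qed
    have "sum ?t ?K = (\<Sum>c\<in>Pair n ` {..<r' n}. ?t c)"
      using rank [OF h(1)] by (intro sum.mono_neutral_left) (auto simp: in_keys_iff image_iff)
    also have "\<dots> = (\<Sum>k<r' n. smul (single 0 (coef f (n, k) 0)) (g n k))"
      by (subst sum.reindex) (auto simp: inj_on_def const)
    finally show ?thesis using K k indep [of "\<lambda>k. coef f (n, k) 0" n k] by simp
  qed
  then show ?thesis using map image by (intro exI [of _ r'] exI [of _ \<phi>]) auto
qed

text \<open>Minimal covers of successive kernels are spliced together. Each differential has the
  previous kernel, or \<open>I\<close> at the start, as its image; so minimality means that these
  modules contain no vector with a nonzero constant coefficient.\<close>

lemma ex_minimal_resolution:
  fixes I :: "('v, 'k::field) mpoly set"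
  assumes I: "graded_submodule V (emb ` I)" "I \<subseteq> poly_ring V" "\<And>p. p \<in> I \<Longrightarrow> lookup p 0 = 0"
  shows "\<exists>b d \<epsilon>. minimal_graded_free_resolution V I b d \<epsilon>"
proof -
  \<comment> \<open>A state consists of the ranks of the current free module and the submodule to be
    covered next. The clause for 0 fixes the initial state through the dependent choice.\<close>
  define P :: "nat \<Rightarrow> (nat \<Rightarrow> nat) \<times> ('v, 'k) fvec set \<Rightarrow> bool"
    where "P n = (\<lambda>(r, N). graded_submodule V N \<and> N \<subseteq> free_module V r
      \<and> (\<forall>f\<in>N. \<forall>c. coef f c 0 = 0) \<and> (n = 0 \<longrightarrow> r = rank_one \<and> N = emb ` I))" for n
  define Q :: "nat \<Rightarrow> (nat \<Rightarrow> nat) \<times> ('v, 'k) fvec set \<Rightarrow> (nat \<Rightarrow> nat) \<times> ('v, 'k) fvec set \<Rightarrow> bool"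
    where "Q n = (\<lambda>(r, N) (r', N'). \<exists>\<phi>. graded_map V r' r \<phi> \<and> \<phi> ` free_module V r' = N
      \<and> N' = {f \<in> free_module V r'. \<phi> f = 0})" for n
  have "\<exists>x. P 0 x"
    using I by (intro exI [of _ "(rank_one, emb ` I)"]) (auto simp: P_def emb_free_module coef_emb)
  moreover have "\<exists>y. P (Suc n) y \<and> Q n x y" if x: "P n x" for n x
  proof -
    obtain r N where rN: "x = (r, N)" by (cases x)
    obtain r' \<phi> where \<phi>: "graded_map V r' r \<phi>" "\<phi> ` free_module V r' = N"
      "\<forall>f\<in>free_module V r'. \<phi> f = 0 \<longrightarrow> (\<forall>c. coef f c 0 = 0)"
      using minimal_free_cover [of N r] x by (auto simp: P_def rN)
    then show ?thesis
      using graded_preimage [OF \<phi>(1), of "{0}"]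
      by (intro exI [of _ "(r', {f \<in> free_module V r'. \<phi> f = 0})"]) (auto simp: P_def Q_def rN)
  qed
  ultimately obtain s where s: "\<And>n. P n (s n)" "\<And>n. Q n (s n) (s (Suc n))"
    using dependent_nat_choice [of P Q] by metis
  define b where "b n = fst (s n)" for n
  define N where "N n = snd (s n)" for n
  have PN: "N n \<subseteq> free_module V (b n)" "f \<in> N n \<Longrightarrow> coef f c 0 = 0" for n f c
    using s(1) [of n] by (auto simp: P_def b_def N_def simp del: split_paired_All split: prod.splits)
  have P0: "b 0 = rank_one" "N 0 = emb ` I"
    using s(1) [of 0] by (auto simp: P_def b_def N_def split: prod.splits)
  have "\<forall>n. \<exists>\<phi>. graded_map V (b (Suc n)) (b n) \<phi> \<and> \<phi> ` free_module V (b (Suc n)) = N n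
      \<and> N (Suc n) = {f \<in> free_module V (b (Suc n)). \<phi> f = 0}"
  proof
    fix n
    show "\<exists>\<phi>. graded_map V (b (Suc n)) (b n) \<phi> \<and> \<phi> ` free_module V (b (Suc n)) = N n
      \<and> N (Suc n) = {f \<in> free_module V (b (Suc n)). \<phi> f = 0}"
      using s(2) [of n] by (cases "s n"; cases "s (Suc n)") (simp add: Q_def b_def N_def)
  qed
  from choice [OF this] obtain d
    where d: "\<forall>n. graded_map V (b (Suc n)) (b n) (d n) \<and> d n ` free_module V (b (Suc n)) = N n
      \<and> N (Suc n) = {f \<in> free_module V (b (Suc n)). d n f = 0}" ..
  have d_map: "graded_map V (b (Suc n)) (b n) (d n)" for n
    using d [THEN spec, of n] by (rule conjunct1)
  have d_image: "d n ` free_module V (b (Suc n)) = N n" for n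
    using d [THEN spec, of n] by (elim conjE)
  have d_ker: "N (Suc n) = {f \<in> free_module V (b (Suc n)). d n f = 0}" for n
    using d [THEN spec, of n] by (elim conjE)
  define \<epsilon> :: "('v, 'k) fvec \<Rightarrow> ('v, 'k) mpoly" where "\<epsilon> f = lookup f (0, 0)" for f
  have \<epsilon>emb [simp]: "\<epsilon> (emb p) = p" for p by (simp add: \<epsilon>_def emb_def)
  have "minimal_graded_free_resolution V I b d \<epsilon>"
    unfolding minimal_graded_free_resolution_def
  proof (intro conjI allI ballI)
    show "graded_linear V (b 0) (*) homogeneous (poly_ring V) \<epsilon>"
      by (auto simp: graded_linear_def P0 free_module_rank_one emb_smul emb_add [symmetric] homogeneous_emb)
    show "graded_map V (b (Suc i)) (b i) (d i)" for i by (rule d_map)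
    show "\<exists>f\<in>free_module V (b 0). p - \<epsilon> f \<in> I" if "p \<in> poly_ring V" for p
      using that I submodule_overD(1) [of V "emb ` I"] emb_in_iff [of 0 I]
      by (intro bexI [of _ "emb p"]) (auto simp: P0 emb_free_module graded_submodule_def simp del: emb_in_iff)
    show "d 0 ` free_module V (b 1) = {f \<in> free_module V (b 0). \<epsilon> f \<in> I}"
      using d_image [of 0] I(2) by (auto simp: P0 free_module_rank_one)
    show "d (Suc i) ` free_module V (b (Suc (Suc i))) = {f \<in> free_module V (b (Suc i)). d i f = 0}" for i
      using d_image [of "Suc i"] d_ker [of i] by simp
    show "lookup (lookup (d i f) c) 0 = 0" if "f \<in> free_module V (b (Suc i))" for i f c
      using PN(2) [of "d i f" i c] d_image [of i] that by (auto simp: coef_def)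
  qed
  then show ?thesis by blast
qed

end

section \<open>Edge ideals\<close>

text \<open>Membership decided monomial by monomial: this form makes the grading evident and
  non-membership easy to check.\<close>

definition monomial_ideal :: "'v set \<Rightarrow> 'v set set \<Rightarrow> ('v, 'k::field) mpoly set" where
  "monomial_ideal V E = {p \<in> poly_ring V. \<forall>m\<in>keys p. \<exists>e\<in>E. e \<subseteq> keys m}"

lemma keys_add_nat: "keys (m + n) = keys m \<union> keys n" for m n :: "'v \<Rightarrow>\<^sub>0 nat"
  by (auto simp: in_keys_iff lookup_add)

lemma is_ideal_monomial_ideal: "is_ideal V (monomial_ideal V E :: ('v, 'k::field) mpoly set)"
  unfolding is_ideal_def
proof (intro conjI ballI)
  fix p q :: "('v, 'k) mpoly" assume "p \<in> monomial_ideal V E" "q \<in> monomial_ideal V E"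
  then show "p + q \<in> monomial_ideal V E"
    using keys_add [of p q] unfolding monomial_ideal_def by (blast intro: poly_ring_add)
next
  fix r p :: "('v, 'k) mpoly" assume r: "r \<in> poly_ring V" and p: "p \<in> monomial_ideal V E"
  have "\<exists>e\<in>E. e \<subseteq> keys m" if "m \<in> keys (r * p)" for m
  proof -
    obtain a b where ab: "m = a + b" "b \<in> keys p" using keys_mult [of r p] \<open>m \<in> keys (r * p)\<close> by blast
    then obtain e where "e \<in> E" "e \<subseteq> keys b" using p by (auto simp: monomial_ideal_def)
    then show ?thesis by (auto simp: ab keys_add_nat)
  qed
  then show "r * p \<in> monomial_ideal V E"
    using r p by (auto simp: monomial_ideal_def intro: poly_ring_mult)
qed (auto simp: monomial_ideal_def poly_ring_closed)

lemma is_ideal_sum: "is_ideal V I \<Longrightarrow> (\<And>x. x \<in> X \<Longrightarrow> F x \<in> I) \<Longrightarrow> sum F X \<in> I"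
  by (induction X rule: infinite_finite_induct) (auto simp: is_ideal_def)

lemma edge_ideal_eq_monomial_ideal:
  assumes "finite_simple_graph V E"
  shows "edge_ideal V E = (monomial_ideal V E :: ('v, 'k::field) mpoly set)"
  unfolding edge_ideal_def
proof (rule hull_unique)
  let ?gens = "{var x * var y | x y. {x, y} \<in> E} :: ('v, 'k) mpoly set"
  have var_mult: "var x * var y = (single (single x 1 + single y 1) 1 :: ('v, 'k) mpoly)" for x y
    by (simp add: var_def mult_single)
  have edge: "x \<in> V" "y \<in> V" "x \<noteq> y" if "{x, y} \<in> E" for x y
    using assms that by (auto simp: finite_simple_graph_def dest!: bspec [of E])
  show "?gens \<subseteq> monomial_ideal V E"
    using edge by (auto simp: monomial_ideal_def poly_ring_def var_mult keys_add_nat)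
      (metis insert_commute order_refl)
  show "is_ideal V (monomial_ideal V E)" by (rule is_ideal_monomial_ideal)
  fix I :: "('v, 'k) mpoly set" assume gens: "?gens \<subseteq> I" and I: "is_ideal V I"
  show "monomial_ideal V E \<subseteq> I"
  proof
    fix p :: "('v, 'k) mpoly" assume p: "p \<in> monomial_ideal V E"
    have "single m (lookup p m) \<in> I" if m: "m \<in> keys p" for m
    proof -
      have mV: "keys m \<subseteq> V" using p m by (auto simp: monomial_ideal_def poly_ring_def)
      obtain e where e: "e \<in> E" "e \<subseteq> keys m" using p m by (auto simp: monomial_ideal_def)
      then obtain x y where xy: "e = {x, y}" "x \<noteq> y"
        using assms by (auto simp: finite_simple_graph_def card_2_iff)
      let ?n = "m - (single x 1 + single y 1)"
      \<comment> \<open>As \<open>x\<close> and \<open>y\<close> are distinct, exponents at least 1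
        suffice for the truncated subtraction to be exact.\<close>
      have "?n + (single x 1 + single y 1) = m"
        using e xy by (intro poly_mapping_eqI)
          (auto simp: lookup_add lookup_minus lookup_single when_def in_keys_iff)
      then have "single m (lookup p m) = single ?n (lookup p m) * (var x * var y)"
        by (simp add: var_mult mult_single)
      moreover have "single ?n (lookup p m) \<in> poly_ring V"
        using mV by (auto simp: poly_ring_def in_keys_iff lookup_minus)
      moreover have "var x * var y \<in> I" using gens e xy by auto
      ultimately show ?thesis using I by (simp add: is_ideal_def)
    qed
    moreover have "p = (\<Sum>m\<in>keys p. single m (lookup p m))"
      by (rule poly_mapping_eqI) (auto simp: lookup_sum lookup_single when_def in_keys_iff)
    ultimately show "p \<in> I" using is_ideal_sum [OF I] by metis
  qed
qed

text \<open>Taking a component only deletes monomials, and membership is a condition on each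
  remaining one.\<close>

lemma graded_monomial_ideal: "graded_submodule V (emb ` monomial_ideal V E :: ('v, 'k::field) fvec set)"
  unfolding graded_submodule_def submodule_over_def
proof (intro conjI ballI allI)
  let ?I = "monomial_ideal V E :: ('v, 'k) mpoly set"
  have ideal: "0 \<in> ?I" "p \<in> ?I \<Longrightarrow> q \<in> ?I \<Longrightarrow> p + q \<in> ?I" "p \<in> poly_ring V \<Longrightarrow> q \<in> ?I \<Longrightarrow> p * q \<in> ?I" for p q
    using is_ideal_monomial_ideal [of V E] by (auto simp: is_ideal_def)
  show "0 \<in> emb ` ?I" using ideal(1) emb_0 by (metis image_eqI)
  show "f + g \<in> emb ` monomial_ideal V E"
    if "f \<in> emb ` monomial_ideal V E" "g \<in> emb ` monomial_ideal V E" for f g :: "('v, 'k) fvec"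
    using that ideal by (auto simp: emb_add [symmetric])
  show "smul p f \<in> emb ` monomial_ideal V E"
    if "p \<in> poly_ring V" "f \<in> emb ` monomial_ideal V E" for p and f :: "('v, 'k) fvec"
    using that ideal by (auto simp: emb_smul)
  fix n and f :: "('v, 'k) fvec" assume "f \<in> emb ` monomial_ideal V E"
  then obtain p where p: "f = emb p" "p \<in> monomial_ideal V E" by blast
  define q where "q = lookup (component n f) (0, 0)"
  have q: "lookup q m = (if mon_degree m = n then lookup p m else 0)" for m
    using coef_component [of n f "(0, 0)" m] by (simp add: q_def coef_def p emb_def)
  then have "component n f = emb q"
    by (intro fvec_eqI) (auto simp: coef_component coef_emb p)
  moreover have "q \<in> monomial_ideal V E"
    using p(2) q by (auto simp: monomial_ideal_def poly_ring_def in_keys_iff split: if_splits)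
  ultimately show "component n f \<in> emb ` monomial_ideal V E" by simp
qed

section \<open>Squarefree multidegrees and the bouquet cycle\<close>

definition squarefree_monomial :: "'v set \<Rightarrow> 'v \<Rightarrow>\<^sub>0 nat" where
  "squarefree_monomial X = (\<Sum>x\<in>X. single x 1)"

lemma lookup_squarefree_monomial:
  "finite X \<Longrightarrow> lookup (squarefree_monomial X) v = (if v \<in> X then 1 else 0)"
  by (simp add: squarefree_monomial_def lookup_sum lookup_single when_def)

lemma keys_squarefree_monomial: "finite X \<Longrightarrow> keys (squarefree_monomial X) = X"
  by (auto simp: in_keys_iff lookup_squarefree_monomial split: if_splits)

lemma mon_degree_squarefree_monomial: "finite X \<Longrightarrow> mon_degree (squarefree_monomial X) = card X"
  by (simp add: mon_degree_def keys_squarefree_monomial lookup_squarefree_monomial)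

lemma squarefree_monomial_remove:
  "finite X \<Longrightarrow> v \<in> X \<Longrightarrow> squarefree_monomial X - single v 1 = squarefree_monomial (X - {v})"
  by (intro poly_mapping_eqI)
    (auto simp: lookup_minus lookup_squarefree_monomial lookup_single when_def)

text \<open>A variable contributes only if it divides the monomial. As
  \<open>insert v (W - X)\<close> is the complement of \<open>X - {v}\<close> in \<open>W\<close>,
  this is a simplicial coboundary: the value at \<open>X\<close> comes from its faces of codimension
  one.\<close>

lemma (in ordered_variables) coef_boundary_squarefree:
  assumes "X \<subseteq> W" "W \<subseteq> V"
  shows "coef (boundary u (W - X)) c (squarefree_monomial X)
    = (\<Sum>v\<in>X. sg v (W - X) * coef (u (insert v (W - X))) c (squarefree_monomial (X - {v})))"
proof -
  have X: "finite X" "X \<subseteq> V - (W - X)" using assms finite_V by (auto intro: finite_subset)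
  have "coef (boundary u (W - X)) c (squarefree_monomial X)
    = (\<Sum>v\<in>V - (W - X). if v \<in> X then sg v (W - X) * coef (u (insert v (W - X))) c (squarefree_monomial (X - {v})) else 0)"
    unfolding boundary_def coef_sum coef_scale coef_var using X(1)
    by (intro sum.cong) (auto simp: lookup_squarefree_monomial squarefree_monomial_remove simp del: One_nat_def)
  also have "\<dots> = (\<Sum>v\<in>(V - (W - X)) \<inter> X. sg v (W - X) * coef (u (insert v (W - X))) c (squarefree_monomial (X - {v})))"
    using finite_V by (simp add: sum.inter_restrict)
  also have "(V - (W - X)) \<inter> X = X" using X by auto
  finally show ?thesis .
qed

text \<open>The cycle $(\prod_{w \in R} w)\, e_F$ is not a boundary: the stems span a cross-polytope in the independence
  complex, and summing the coefficients at the complements of its facets is a cocycle.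
  All its signs are 1 because the two vertices of each stem are consecutive in the order.\<close>

lemma (in ordered_variables) koszul_class_bouquets:
  fixes p :: "'v \<Rightarrow> 'v" and E :: "'v set set"
  assumes W: "R \<union> F \<subseteq> V" "R \<inter> F = {}" and p: "p ` R \<subseteq> F" "inj_on p R"
    and flower: "\<And>z. z \<in> F \<Longrightarrow> \<exists>w\<in>R. {w, z} \<in> E"
    and indep: "\<And>Q e. Q \<subseteq> R \<Longrightarrow> e \<in> E \<Longrightarrow> \<not> e \<subseteq> Q \<union> p ` (R - Q)"
    and num: "\<And>w. w \<in> R \<Longrightarrow> num w < num (p w)"
    and consecutive: "\<And>w t. w \<in> R \<Longrightarrow> t \<in> V \<Longrightarrow> t \<noteq> w \<Longrightarrow> t \<noteq> p w \<Longrightarrow> num t < num w \<longleftrightarrow> num t < num (p w)"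
  shows "koszul_class (free_module V rank_one) (emb ` monomial_ideal V E) (card F) (card F + card R)
    (\<lambda>T. if T = F then emb (single (squarefree_monomial R) (1::'k::field)) else 0)"
    (is "koszul_class ?S ?J _ _ ?c")
  unfolding koszul_class_def
proof (intro conjI allI impI notI)
  have fin: "finite R" "finite F" using W finite_V by (auto intro: finite_subset)
  have J: "submodule_over V ?J" by (rule conjunct1 [OF graded_monomial_ideal [unfolded graded_submodule_def]])
  have mon: "single (squarefree_monomial R) (1::'k) \<in> poly_ring V"
    using W fin by (auto simp: poly_ring_def keys_squarefree_monomial)
  {
    fix T assume "T \<subseteq> V" "card T = card F"
    show "?c T \<in> ?S" using mon by (simp add: emb_free_module submodule_overD(1) [OF submodule_free_module])
    show "fvec_homogeneous (card F + card R - card F) (?c T)"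
      using fin by (simp add: homogeneous_emb homogeneous_def mon_degree_squarefree_monomial)
  next
    fix T assume "T \<subseteq> V" "Suc (card T) = card F"
    have "smul (var v) (?c (insert v T)) \<in> ?J" if "v \<in> V - T" for v
    proof (cases "insert v T = F")
      case True
      then obtain w where w: "w \<in> R" "{w, v} \<in> E" using flower by blast
      have "var v * single (squarefree_monomial R) (1::'k) = single (single v 1 + squarefree_monomial R) 1"
        by (simp add: var_def mult_single)
      moreover have "\<dots> \<in> monomial_ideal V E"
        using w that W fin
        by (auto simp: monomial_ideal_def poly_ring_def keys_add_nat keys_squarefree_monomial intro!: bexI [of _ "{w, v}"])
      ultimately show ?thesis using True by (simp add: emb_smul)
    qed (simp add: submodule_overD(1) [OF J])
    then show "boundary ?c T \<in> ?J"
      unfolding boundary_def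
      by (intro submodule_over_sum [OF J] submodule_overD(3) [OF J poly_ring_closed(3)])
  next
    assume "\<exists>u. (\<forall>T\<subseteq>V. card T = Suc (card F) \<longrightarrow> u T \<in> ?S) \<and>
        (\<forall>T\<subseteq>V. card T = card F \<longrightarrow> ?c T - boundary u T \<in> ?J)"
    then obtain u where u: "\<And>T. T \<subseteq> V \<Longrightarrow> card T = card F \<Longrightarrow> ?c T - boundary u T \<in> ?J" by blast
    let ?W = "R \<union> F"
    \<comment> \<open>The transversal of the stems that takes the root on \<open>Q\<close> and the
      partner flower elsewhere, that is, a facet of the cross-polytope.\<close>
    define X where "X Q = Q \<union> p ` (R - Q)" for Q
    define \<Phi> where "\<Phi> f = (\<Sum>Q\<in>Pow R. coef (f (?W - X Q)) (0, 0) (squarefree_monomial (X Q)))"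
      for f :: "'v set \<Rightarrow> ('v, 'k) fvec"
    have XW: "X Q \<subseteq> ?W" "finite (X Q)" if "Q \<subseteq> R" for Q
      using that p fin by (auto simp: X_def intro: finite_subset)
    have card: "card (?W - X Q) = card F" if Q: "Q \<subseteq> R" for Q
    proof -
      have "card (X Q) = card Q + card (p ` (R - Q))"
        unfolding X_def using Q fin p W by (intro card_Un_disjoint) (auto intro: finite_subset)
      also have "card (p ` (R - Q)) = card (R - Q)" using p by (intro card_image) (auto intro: inj_on_subset)
      also have "card Q + card (R - Q) = card R"
        using Q fin by (metis card_Diff_subset card_mono finite_subset le_add_diff_inverse)
      finally show ?thesis
        using XW [OF Q] fin W by (simp add: card_Diff_subset card_Un_disjoint)
    qed
    \<comment> \<open>A transversal contains no edge, so its monomial occurs in no element of the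
      ideal; coefficients there are well defined modulo the ideal.\<close>
    have zero: "coef (?c (?W - X Q) - boundary u (?W - X Q)) (0, 0) (squarefree_monomial (X Q)) = 0"
      if Q: "Q \<subseteq> R" for Q
    proof -
      have "?c (?W - X Q) - boundary u (?W - X Q) \<in> ?J" using W card [OF Q] by (intro u) auto
      then obtain q where q: "?c (?W - X Q) - boundary u (?W - X Q) = emb q" "q \<in> monomial_ideal V E" by blast
      have "squarefree_monomial (X Q) \<notin> keys q"
        using q(2) indep [OF Q] XW [OF Q] by (auto simp: monomial_ideal_def keys_squarefree_monomial X_def)
      then show ?thesis unfolding q(1) by (simp add: coef_emb in_keys_iff)
    qed
    have "\<Phi> ?c - \<Phi> (boundary u) = 0"
      unfolding \<Phi>_def sum_subtractf [symmetric] using zero by (intro sum.neutral) auto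
    moreover have "\<Phi> ?c = 1"
    proof -
      have "?W - X Q = F \<longleftrightarrow> Q = R" if "Q \<subseteq> R" for Q
      proof
        assume eq: "?W - X Q = F"
        have "x \<in> Q" if "x \<in> R" for x
        proof (rule ccontr)
          assume "x \<notin> Q"
          then have "p x \<in> X Q" "p x \<in> F" using that p by (auto simp: X_def)
          then show False using eq by blast
        qed
        then show "Q = R" using \<open>Q \<subseteq> R\<close> by blast
      qed (use W in \<open>auto simp: X_def\<close>)
      then have "\<Phi> ?c = (\<Sum>Q\<in>Pow R. if Q = R then 1 else 0)"
        unfolding \<Phi>_def by (intro sum.cong) (auto simp: coef_emb X_def)
      then show ?thesis using fin by simp
    qed
    moreover have "\<Phi> (boundary u) = 0"
    proof -
      define t where "t Q v = sg v (?W - X Q) * coef (u (insert v (?W - X Q))) (0, 0) (squarefree_monomial (X Q - {v}))"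
        for Q v
      \<comment> \<open>Vertices of a transversal are indexed by their stems, so that the double sum
        can be regrouped by stem.\<close>
      define sel where "sel Q w = (if w \<in> Q then w else p w)" for Q w
      have "(\<Sum>v\<in>X Q. t Q v) = (\<Sum>w\<in>R. t Q (sel Q w))" if Q: "Q \<subseteq> R" for Q
      proof (rule sum.reindex_bij_betw [symmetric])
        have "sel Q ` R = X Q" using Q by (auto simp: sel_def X_def)
        moreover have "inj_on (sel Q) R"
          using p W Q by (auto simp: inj_on_def sel_def)
        ultimately show "bij_betw (sel Q) R (X Q)" by (simp add: bij_betw_def)
      qed
      then have "\<Phi> (boundary u) = (\<Sum>Q\<in>Pow R. \<Sum>w\<in>R. t Q (sel Q w))"
        unfolding \<Phi>_def using XW W
        by (intro sum.cong) (auto simp: coef_boundary_squarefree t_def)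
      also have "\<dots> = (\<Sum>w\<in>R. \<Sum>Q\<in>Pow R. t Q (sel Q w))" by (rule sum.swap)
      also have "\<dots> = 0"
      proof (rule sum.neutral, rule ballI)
        fix w assume w: "w \<in> R"
        \<comment> \<open>The two facets that differ only on the stem of \<open>w\<close> share the
          ridge \<open>Y\<close>. They involve the same coefficient of \<open>u\<close> and
          cancel.\<close>
        have pair: "t (insert w Q) w + t Q (p w) = 0" if Q: "Q \<subseteq> R - {w}" for Q
        proof -
          define Y where "Y = Q \<union> p ` (R - insert w Q)"
          have X1: "X (insert w Q) = insert w Y" and X2: "X Q = insert (p w) Y"
            using w Q by (auto simp: X_def Y_def)
          have Y: "w \<notin> Y" "p w \<notin> Y" "w \<noteq> p w" "p w \<in> ?W"
            using w Q p W by (auto simp: Y_def dest: inj_onD)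
          let ?T = "?W - Y - {w}" and ?T' = "?W - Y - {p w}"
          have T: "?W - X (insert w Q) = ?T" "?W - X Q = ?T'" by (auto simp: X1 X2)
          \<comment> \<open>The root \<open>w\<close> is the only element counted additionally, as
            nothing lies between it and \<open>p w\<close>.\<close>
          have "{t \<in> ?T'. num t < num (p w)} = insert w {t \<in> ?T. num t < num w}"
            using consecutive [OF w] num [OF w] w W Y by (auto dest: less_trans)
          moreover have "w \<notin> {t \<in> ?T. num t < num w}" by simp
          moreover have "finite {t \<in> ?T. num t < num w}" using fin by simp
          ultimately have sign: "sg (p w) ?T' = (- sg w ?T :: 'k)" by (simp add: sg_def)
          have ins: "insert w ?T = ?W - Y" "insert (p w) ?T' = ?W - Y" using w Y by auto
          have rem: "insert w Y - {w} = Y" "insert (p w) Y - {p w} = Y" using Y by auto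
          show ?thesis unfolding t_def T unfolding X1 X2 ins rem sign by simp
        qed
        have "Pow R = Pow (R - {w}) \<union> insert w ` Pow (R - {w})"
          using w Pow_insert [of w "R - {w}"] by (simp add: insert_absorb)
        then have "(\<Sum>Q\<in>Pow R. t Q (sel Q w))
          = (\<Sum>Q\<in>Pow (R - {w}). t Q (sel Q w)) + (\<Sum>Q\<in>insert w ` Pow (R - {w}). t Q (sel Q w))"
          using fin by (simp only:) (rule sum.union_disjoint, auto)
        also have "(\<Sum>Q\<in>insert w ` Pow (R - {w}). t Q (sel Q w)) = (\<Sum>Q\<in>Pow (R - {w}). t (insert w Q) w)"
          by (subst sum.reindex) (auto simp: inj_on_def sel_def)
        also have "(\<Sum>Q\<in>Pow (R - {w}). t Q (sel Q w)) = (\<Sum>Q\<in>Pow (R - {w}). t Q (p w))"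
          by (intro sum.cong) (auto simp: sel_def)
        also have "(\<Sum>Q\<in>Pow (R - {w}). t Q (p w)) + (\<Sum>Q\<in>Pow (R - {w}). t (insert w Q) w) = 0"
          unfolding sum.distrib [symmetric] using pair by (intro sum.neutral) (simp add: add.commute)
        finally show "(\<Sum>Q\<in>Pow R. t Q (sel Q w)) = 0" .
      qed
      finally show ?thesis .
    qed
    ultimately show False by simp
  }
qed

section \<open>Strongly disjoint bouquets\<close>

text \<open>An edge joining two stems is the middle of a path of length two. Hence stems at distance
  at least 3 form an induced matching.\<close>

lemma edge_dist_le:
  assumes "e \<in> E" "f \<in> E" "e' \<in> E" "e \<inter> f \<noteq> {}" "f \<inter> e' \<noteq> {}"
  shows "edge_dist E e e' \<le> 2"
proof -
  let ?s = "\<lambda>k::nat. if k = 0 then e else if k = 1 then f else e'"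
  have "edge_dist E e e' \<le> enat 2"
    unfolding edge_dist_def using assms
    by (intro Inf_lower CollectI exI [of _ "2::nat"] exI [of _ ?s] conjI refl) (auto simp: less_2_cases_iff)
  then show ?thesis by (simp add: numeral_eq_enat)
qed

text \<open>Deleting edges removes walks, so 3-disjointness passes to induced subgraphs that retain
  the chosen stems.\<close>

lemma edge_dist_mono:
  assumes "E' \<subseteq> E"
  shows "edge_dist E e e' \<le> edge_dist E' e e'"
  unfolding edge_dist_def using assms by (intro Inf_superset_mono) blast

lemma betti_nonzero:
  fixes V :: "'v set" and E :: "'v set set"
  assumes graph: "finite_simple_graph V E" and WV: "W \<subseteq> V"
    and B: "contains_strongly_disjoint W (induced_edges E W) i j"
  shows "betti V (edge_ideal V E :: ('v, 'k::field) mpoly set) i (i + j) \<noteq> 0"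
proof -
  obtain \<B> where sd: "strongly_disjoint W (induced_edges E W) \<B>"
    and card: "card (all_flowers \<B>) = i" "card (all_roots \<B>) = j"
    and W: "W = all_flowers \<B> \<union> all_roots \<B>"
    using B by (auto simp: contains_strongly_disjoint_def)
  have bouquet: "bouquet_of W (induced_edges E W) C" if "C \<in> \<B>" for C
    using sd that by (auto simp: strongly_disjoint_def)
  have disj: "bouquet_verts C \<inter> bouquet_verts C' = {}" if "C \<in> \<B>" "C' \<in> \<B>" "C \<noteq> C'" for C C'
    using sd that by (auto simp: strongly_disjoint_def pairwise_def)
  obtain s where s: "\<And>C. C \<in> \<B> \<Longrightarrow> s C \<in> stems C"
    and far: "pairwise_3_disjoint (induced_edges E W) (s ` \<B>)"
    using sd by (auto simp: strongly_disjoint_def)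
  have "\<forall>C\<in>\<B>. \<exists>z. z \<in> flowers C \<and> s C = {root C, z}" using s by (auto simp: stems_def)
  then obtain z where z: "\<And>C. C \<in> \<B> \<Longrightarrow> z C \<in> flowers C" "\<And>C. C \<in> \<B> \<Longrightarrow> s C = {root C, z C}"
    by metis
  have sV: "s C \<subseteq> bouquet_verts C" if "C \<in> \<B>" for C using z that by (auto simp: bouquet_verts_def)
  have edge2: "\<exists>x y. e = {x, y} \<and> x \<noteq> y" "e \<subseteq> V" if "e \<in> E" for e
    using graph that by (auto simp: finite_simple_graph_def card_2_iff)
  let ?R = "all_roots \<B>" and ?F = "all_flowers \<B>"
  have finV: "finite V" using graph by (simp add: finite_simple_graph_def)
  have inj_root: "inj_on root \<B>"
    using disj by (fastforce simp: inj_on_def bouquet_verts_def)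
  have root_flower: "root C \<notin> flowers C'" if "C \<in> \<B>" "C' \<in> \<B>" for C C'
    using disj [OF that] bouquet [OF that(1)] by (cases "C = C'") (auto simp: bouquet_verts_def bouquet_of_def)
  have RF: "?R \<inter> ?F = {}" using root_flower by (auto simp: all_roots_def all_flowers_def)
  define p where "p w = z (the_inv_into \<B> root w)" for w
  have p: "p (root C) = z C" if "C \<in> \<B>" for C
    using that inj_root by (simp add: p_def the_inv_into_f_f)
  have pF: "p ` ?R \<subseteq> ?F" using p z by (auto simp: all_roots_def all_flowers_def)
  have inj_p: "inj_on p ?R"
  proof (rule inj_onI)
    fix w w' assume ww: "w \<in> ?R" "w' \<in> ?R" "p w = p w'"
    then obtain C C' where C: "C \<in> \<B>" "C' \<in> \<B>" "w = root C" "w' = root C'" by (auto simp: all_roots_def)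
    then have "z C \<in> bouquet_verts C \<inter> bouquet_verts C'"
      using z ww p by (metis IntI bouquet_verts_def insertI2)
    then show "w = w'" using disj C by blast
  qed
  have flower: "\<exists>w\<in>?R. {w, y} \<in> E" if y: "y \<in> ?F" for y
  proof -
    obtain C where C: "C \<in> \<B>" "y \<in> flowers C" using y by (auto simp: all_flowers_def)
    then have "{root C, y} \<in> stems C" "stems C \<subseteq> E"
      using bouquet by (auto simp: bouquet_of_def stems_def induced_edges_def)
    then show ?thesis using C by (auto simp: all_roots_def)
  qed
  \<comment> \<open>An edge between stems of two bouquets belongs to the induced subgraph, since
    both stems do, and would put them at distance at most 2.\<close>
  have same: "C = C'" if C: "C \<in> \<B>" "C' \<in> \<B>" and x: "x \<in> s C" "y \<in> s C'" "{x, y} \<in> E" for C C' x y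
  proof (rule ccontr)
    assume ne: "C \<noteq> C'"
    have "s C \<inter> s C' = {}" using disj [OF C ne] sV C by blast
    then have "s C \<noteq> s C'" using x by blast
    then have "3 \<le> edge_dist (induced_edges E W) (s C) (s C')"
      using far C by (auto simp: pairwise_3_disjoint_def pairwise_def)
    moreover have sE: "s C \<in> induced_edges E W" "s C' \<in> induced_edges E W"
      using far C by (auto simp: pairwise_3_disjoint_def)
    then have "{x, y} \<in> induced_edges E W" using x by (auto simp: induced_edges_def)
    then have "edge_dist (induced_edges E W) (s C) (s C') \<le> 2"
      using sE x by (intro edge_dist_le [of _ _ "{x, y}"]) auto
    ultimately have "(3::enat) \<le> 2" by (rule order_trans)
    then show False by simp
  qed
  have indep: "\<not> e \<subseteq> Q \<union> p ` (?R - Q)" if Q: "Q \<subseteq> ?R" and e: "e \<in> E" for Q e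
  proof
    assume sub: "e \<subseteq> Q \<union> p ` (?R - Q)"
    obtain x y where xy: "e = {x, y}" "x \<noteq> y" using edge2 e by blast
    \<comment> \<open>Both ends of an edge inside a transversal would lie on one stem. This records
      that the root is taken only if it is in \<open>Q\<close> and the flower only if the root is
      not.\<close>
    have stem: "\<exists>C\<in>\<B>. v \<in> s C \<and> (v = root C \<longrightarrow> root C \<in> Q) \<and> (v = z C \<longrightarrow> root C \<notin> Q)"
      if "v \<in> Q \<union> p ` (?R - Q)" for v
      using that
    proof
      assume v: "v \<in> Q"
      then obtain C where C: "C \<in> \<B>" "v = root C" using Q by (auto simp: all_roots_def)
      moreover have "root C \<noteq> z C" using z(1) root_flower C(1) by metis
      ultimately show ?thesis using z v by (intro bexI [of _ C]) auto
    next
      assume "v \<in> p ` (?R - Q)"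
      then obtain C where C: "C \<in> \<B>" "v = z C" "root C \<notin> Q" by (auto simp: all_roots_def p)
      moreover have "root C \<noteq> z C" using z(1) root_flower C(1) by metis
      ultimately show ?thesis using z by (intro bexI [of _ C]) auto
    qed
    obtain C where C: "C \<in> \<B>" "x \<in> s C" "x = root C \<longrightarrow> root C \<in> Q" "x = z C \<longrightarrow> root C \<notin> Q"
      using stem [of x] sub xy by blast
    obtain C' where C': "C' \<in> \<B>" "y \<in> s C'" "y = root C' \<longrightarrow> root C' \<in> Q" "y = z C' \<longrightarrow> root C' \<notin> Q"
      using stem [of y] sub xy by blast
    have "C = C'" using same C C' e xy by blast
    then show False using C C' z xy by auto
  qed
  obtain f :: "'v \<Rightarrow> nat" where f: "inj_on f V" using finite_imp_inj_to_nat_seg [OF finV] by blast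
  text \<open>An order in which each flower of a chosen stem directly follows its root.\<close>
  define \<rho> where "\<rho> v = (if v \<in> p ` ?R then the_inv_into ?R p v else v)" for v
  \<comment> \<open>\<open>\<rho>\<close> collapses a chosen stem to its root. Doubling makes room
    for a parity bit, so root and flower get numbers 2k and 2k + 1.\<close>
  define num where "num v = 2 * f (\<rho> v) + (if v \<in> p ` ?R then 1 else 0)" for v
  have \<rho>p: "\<rho> (p w) = w" if "w \<in> ?R" for w using that inj_p by (simp add: \<rho>_def the_inv_into_f_f)
  have Rp: "w \<notin> p ` ?R" if "w \<in> ?R" for w using that pF RF by blast
  have \<rho>R: "\<rho> w = w" if "w \<notin> p ` ?R" for w using that by (simp add: \<rho>_def)
  have \<rho>V: "\<rho> v \<in> V" if "v \<in> V" for v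
    using that \<rho>p \<rho>R W WV by (cases "v \<in> p ` ?R") auto
  have f\<rho>: "f (\<rho> v) = f (\<rho> v') \<Longrightarrow> \<rho> v = \<rho> v'" if "v \<in> V" "v' \<in> V" for v v'
    using that \<rho>V f by (meson inj_onD)
  have \<rho>_cases: "v = \<rho> v \<or> v = p (\<rho> v)" for v
    using \<rho>p \<rho>R by (cases "v \<in> p ` ?R") auto
  have num_iff: "v \<in> p ` ?R \<longleftrightarrow> odd (num v)" "num v div 2 = f (\<rho> v)" for v by (auto simp: num_def)
  have "inj_on num V"
  proof (rule inj_onI)
    fix v v' assume v: "v \<in> V" "v' \<in> V" "num v = num v'"
    then have eq: "\<rho> v = \<rho> v'" using f\<rho> num_iff(2) by metis
    have iff: "v \<in> p ` ?R \<longleftrightarrow> v' \<in> p ` ?R" using v num_iff(1) by metis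
    show "v = v'"
    proof (cases "v \<in> p ` ?R")
      case True
      then show ?thesis using eq iff \<rho>p by auto
    qed (use eq iff \<rho>R in auto)
  qed
  then interpret ordered_variables V num using finV by unfold_locales
  have "num t < num w \<longleftrightarrow> num t < num (p w)" if w: "w \<in> ?R" and t: "t \<in> V" "t \<noteq> w" "t \<noteq> p w" for w t
  proof -
    have "f (\<rho> t) \<noteq> f w" using f\<rho> [of t w] \<rho>_cases [of t] t w WV W \<rho>R [OF Rp [OF w]] by auto
    then show ?thesis using w Rp [OF w] by (auto simp: num_def \<rho>p \<rho>R)
  qed
  moreover have "num w < num (p w)" if "w \<in> ?R" for w
    using that Rp [OF that] by (simp add: num_def \<rho>p \<rho>R)
  ultimately have nonzero: "koszul_class (free_module V rank_one) (emb ` monomial_ideal V E) (card ?F) (card ?F + card ?R)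
    (\<lambda>T. if T = ?F then emb (single (squarefree_monomial ?R) (1::'k)) else 0)"
    using W WV RF pF inj_p flower indep by (intro koszul_class_bouquets [of _ _ p]) auto
  let ?I = "monomial_ideal V E :: ('v, 'k) mpoly set"
  have "{} \<notin> E" using edge2 by blast
  have "lookup q 0 = 0" if q: "q \<in> ?I" for q
  proof (rule ccontr)
    assume "lookup q 0 \<noteq> 0"
    then have "0 \<in> keys q" by (simp add: in_keys_iff)
    then obtain e where "e \<in> E" "e \<subseteq> keys (0 :: 'v \<Rightarrow>\<^sub>0 nat)"
      using q unfolding monomial_ideal_def by blast
    then show False using \<open>{} \<notin> E\<close> by simp
  qed
  then have "\<exists>b d \<epsilon>. minimal_graded_free_resolution V ?I b d \<epsilon>"
    by (intro ex_minimal_resolution graded_monomial_ideal) (auto simp: monomial_ideal_def)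
  \<comment> \<open>\<open>betti\<close> is a choice of ranks; existence guarantees that the chosen
    ranks belong to a resolution.\<close>
  then have "\<exists>d \<epsilon>. minimal_graded_free_resolution V ?I (betti V ?I) d \<epsilon>"
    unfolding betti_def by (rule someI_ex)
  then show ?thesis
    using betti_nonzero_if_koszul_class [OF _ graded_monomial_ideal nonzero]
    unfolding edge_ideal_eq_monomial_ideal [OF graph] card by auto
qed

text \<open>Reduces the bound by d_G to the first claim: \<open>W\<close> is taken to be the
  vertices covered by the family, and distances in the smaller graph can only grow.\<close>

lemma contains_induced_if_strongly_disjoint:
  assumes "strongly_disjoint V E \<B>"
  defines "W \<equiv> all_flowers \<B> \<union> all_roots \<B>"
  shows "W \<subseteq> V" "contains_strongly_disjoint W (induced_edges E W) (card (all_flowers \<B>)) (card (all_roots \<B>))"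
proof -
  have bouquet: "bouquet_of V E B" if "B \<in> \<B>" for B using assms that by (auto simp: strongly_disjoint_def)
  then show "W \<subseteq> V"
    by (fastforce simp: W_def all_flowers_def all_roots_def bouquet_of_def bouquet_verts_def)
  have vW: "bouquet_verts B \<subseteq> W" if "B \<in> \<B>" for B
    using that by (auto simp: W_def all_flowers_def all_roots_def bouquet_verts_def)
  have stems: "stems B \<subseteq> induced_edges E W" if "B \<in> \<B>" for B
    using vW [OF that] bouquet [OF that]
    by (auto simp: stems_def induced_edges_def bouquet_of_def bouquet_verts_def)
  obtain s where s: "\<forall>B\<in>\<B>. s B \<in> stems B" "pairwise_3_disjoint E (s ` \<B>)"
    using assms by (auto simp: strongly_disjoint_def)
  have "3 \<le> edge_dist (induced_edges E W) e e'" if "e \<in> s ` \<B>" "e' \<in> s ` \<B>" "e \<noteq> e'" for e e'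
  proof -
    have "3 \<le> edge_dist E e e'"
      using s(2) that unfolding pairwise_3_disjoint_def pairwise_def by blast
    also have "\<dots> \<le> edge_dist (induced_edges E W) e e'"
      by (rule edge_dist_mono) (auto simp: induced_edges_def)
    finally show ?thesis .
  qed
  then have "pairwise_3_disjoint (induced_edges E W) (s ` \<B>)"
    using s(1) stems unfolding pairwise_3_disjoint_def pairwise_def by blast
  then have "strongly_disjoint W (induced_edges E W) \<B>"
    using assms bouquet vW stems s unfolding strongly_disjoint_def bouquet_of_def by blast
  then show "contains_strongly_disjoint W (induced_edges E W) (card (all_flowers \<B>)) (card (all_roots \<B>))"
    by (auto simp: contains_strongly_disjoint_def W_def)
qed

theorem theorem3p1:
  fixes V :: "'v set" and E :: "'v set set" and I :: "('v, 'k::field) mpoly set"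
  assumes graph: "finite_simple_graph V E"
    and I: "I = edge_ideal V E"
  shows "(\<forall>i j. (\<exists>W\<subseteq>V. contains_strongly_disjoint W (induced_edges E W) i j) \<longrightarrow>
            betti V I i (i + j) \<noteq> 0)
    \<and> enat (max_flowers V E) \<le> proj_dim V I"
proof
  show betti: "\<forall>i j. (\<exists>W\<subseteq>V. contains_strongly_disjoint W (induced_edges E W) i j) \<longrightarrow>
            betti V I i (i + j) \<noteq> 0"
    using betti_nonzero [OF graph] I by blast
  let ?M = "{card (all_flowers \<B>) | \<B>. strongly_disjoint V E \<B>}"
  have finV: "finite V" using graph by (simp add: finite_simple_graph_def)
  have "?M \<subseteq> {..card V}"
    using contains_induced_if_strongly_disjoint(1) [of V E] card_mono [OF finV] by auto
  then have "finite ?M" by (rule finite_subset) simp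
  \<comment> \<open>The empty family makes the set of flower counts nonempty, so its maximum is
    attained.\<close>
  moreover have "strongly_disjoint V E {}"
    by (simp add: strongly_disjoint_def pairwise_3_disjoint_def)
  ultimately have "Max ?M \<in> ?M" by (intro Max_in) auto
  then obtain \<B> where "strongly_disjoint V E \<B>" "max_flowers V E = card (all_flowers \<B>)"
    by (auto simp: max_flowers_def)
  then have "\<exists>j. betti V I (max_flowers V E) j \<noteq> 0"
    using betti contains_induced_if_strongly_disjoint [of V E \<B>] by metis
  then show "enat (max_flowers V E) \<le> proj_dim V I"
    unfolding proj_dim_def by (intro Sup_upper) blast
qed

end
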